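(* For every constant $k$, the Exact-Simultaneous-Dipaths problem with $k$ color classes can be solved in polynomial time on instances in which the digraph is acyclic.
   Context: Exact-Simultaneous-Dipaths: the input is a positive integer $k$, a digraph $D=(V,A)$ with $A=A_1\cup\cdots\cup A_k$ (the color classes $A_i$ are not necessarily disjoint), two distinct vertices $s,t\in V$, and a conservative cost function $c\colon A\to\mathbb{R}$, where conservative means that there is no directed cycle of negative total cost. The task is to find $A'\subseteq A$ of minimum cost $\sum_{a\in A'}c(a)$ such that $A'\cap A_i$ is (exactly the arc set of) an $s$-$t$ dipath for all $i\in\{1,\ldots,k\}$, or to determine that no such $A'$ exists. A dipath is a directed path with no repeated vertices, identified with its arc set. Digraphs are finite and may have parallel arcs. *)

theory Defs
  imports
    "Graph_Theory.Arc_Walk"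
    "HOL-Computational_Algebra.Polynomial"
begin

section \<open>Exact-Simultaneous-Dipaths\<close>

definition conservative :: "('v, 'a) pre_digraph \<Rightarrow> ('a \<Rightarrow> real) \<Rightarrow> bool" where
  "conservative G c \<longleftrightarrow> (\<forall>p. pre_digraph.cycle G p \<longrightarrow> sum_list (map c p) \<ge> 0)"

text \<open>The library's notion of cycle includes loops and pairs of antiparallel arcs.\<close>
definition acyclic_digraph :: "('v, 'a) pre_digraph \<Rightarrow> bool" where
  "acyclic_digraph G \<longleftrightarrow> (\<nexists>p. pre_digraph.cycle G p)"

definition is_dipath :: "('v, 'a) pre_digraph \<Rightarrow> 'v \<Rightarrow> 'v \<Rightarrow> 'a set \<Rightarrow> bool" where
  "is_dipath G s t B \<longleftrightarrow> (\<exists>p. pre_digraph.apath G s p t \<and> set p = B)"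

record ('v, 'a) esd =
  graph_of :: "('v, 'a) pre_digraph"
  colour :: "nat \<Rightarrow> 'a set"
  source :: 'v
  target :: 'v
  cost :: "'a \<Rightarrow> real"

definition esd_instance :: "nat \<Rightarrow> ('v, 'a) esd \<Rightarrow> bool" where
  "esd_instance k I \<longleftrightarrow>
     k \<ge> 1 \<and> fin_digraph (graph_of I) \<and>
     arcs (graph_of I) = (\<Union>i\<in>{1..k}. colour I i) \<and>
     source I \<in> verts (graph_of I) \<and> target I \<in> verts (graph_of I) \<and> source I \<noteq> target I \<and>
     conservative (graph_of I) (cost I)"

definition esd_feasible :: "nat \<Rightarrow> ('v, 'a) esd \<Rightarrow> 'a set \<Rightarrow> bool" where
  "esd_feasible k I B \<longleftrightarrow>
     B \<subseteq> arcs (graph_of I) \<and>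
     (\<forall>i\<in>{1..k}. is_dipath (graph_of I) (source I) (target I) (B \<inter> colour I i))"

definition esd_optimal :: "nat \<Rightarrow> ('v, 'a) esd \<Rightarrow> 'a set \<Rightarrow> bool" where
  "esd_optimal k I B \<longleftrightarrow>
     esd_feasible k I B \<and>
     (\<forall>B'. esd_feasible k I B' \<longrightarrow> sum (cost I) B \<le> sum (cost I) B')"


section \<open>Random access machine programs with real data\<close>

text \<open>
  Costs are arbitrary real numbers, so the machine model is a real RAM, here in the form of
  structured programs over named unbounded arrays (a scalar is cell 0 of its array). There are
  arrays of natural numbers, used for control and addressing, and arrays of real numbers.

  The instruction set keeps unit-cost time polynomially related to Turing machine time. There is
  no multiplication, so in \<open>T\<close> steps naturals only reach \<open>O(T)\<close> bits beyond those of the input.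
  Reals can be added, subtracted, compared and stored, but not rounded or converted to naturals,
  and the only real constant is 0 (arbitrary ones could carry non-uniform advice). Hence every
  real value arising is an integer combination, with coefficients of \<open>O(T)\<close> bits, of the real inputs.
\<close>

datatype nexp =
    NConst nat
  | NCell string nexp
  | NPlus nexp nexp
  | NMinus nexp nexp

datatype rexp =
    RZero
  | RCell string nexp
  | RPlus rexp rexp
  | RMinus rexp rexp

datatype bexp =
    NLess nexp nexp
  | RLess rexp rexp
  | BNot bexp
  | BAnd bexp bexp

datatype com =
    Skip
  | NAssign string nexp nexp
  | RAssign string nexp rexp
  | Seq com com
  | Ite bexp com com
  | While bexp com

record state =
  nmem :: "string \<Rightarrow> nat \<Rightarrow> nat"
  rmem :: "string \<Rightarrow> nat \<Rightarrow> real"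

text \<open>Subtraction of naturals is truncated.\<close>

fun nval :: "nexp \<Rightarrow> state \<Rightarrow> nat" where
  "nval (NConst n) \<sigma> = n"
| "nval (NCell x e) \<sigma> = nmem \<sigma> x (nval e \<sigma>)"
| "nval (NPlus e f) \<sigma> = nval e \<sigma> + nval f \<sigma>"
| "nval (NMinus e f) \<sigma> = nval e \<sigma> - nval f \<sigma>"

fun rval :: "rexp \<Rightarrow> state \<Rightarrow> real" where
  "rval RZero \<sigma> = 0"
| "rval (RCell x e) \<sigma> = rmem \<sigma> x (nval e \<sigma>)"
| "rval (RPlus e f) \<sigma> = rval e \<sigma> + rval f \<sigma>"
| "rval (RMinus e f) \<sigma> = rval e \<sigma> - rval f \<sigma>"

fun bval :: "bexp \<Rightarrow> state \<Rightarrow> bool" where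
  "bval (NLess e f) \<sigma> \<longleftrightarrow> nval e \<sigma> < nval f \<sigma>"
| "bval (RLess e f) \<sigma> \<longleftrightarrow> rval e \<sigma> < rval f \<sigma>"
| "bval (BNot b) \<sigma> \<longleftrightarrow> \<not> bval b \<sigma>"
| "bval (BAnd b b') \<sigma> \<longleftrightarrow> bval b \<sigma> \<and> bval b' \<sigma>"

text \<open>Evaluating an expression takes one time unit per node.\<close>

fun ntime :: "nexp \<Rightarrow> nat" where
  "ntime (NConst n) = 1"
| "ntime (NCell x e) = 1 + ntime e"
| "ntime (NPlus e f) = 1 + ntime e + ntime f"
| "ntime (NMinus e f) = 1 + ntime e + ntime f"

fun rtime :: "rexp \<Rightarrow> nat" where
  "rtime RZero = 1"
| "rtime (RCell x e) = 1 + ntime e"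
| "rtime (RPlus e f) = 1 + rtime e + rtime f"
| "rtime (RMinus e f) = 1 + rtime e + rtime f"

fun btime :: "bexp \<Rightarrow> nat" where
  "btime (NLess e f) = 1 + ntime e + ntime f"
| "btime (RLess e f) = 1 + rtime e + rtime f"
| "btime (BNot b) = 1 + btime b"
| "btime (BAnd b b') = 1 + btime b + btime b'"

definition nwrite :: "string \<Rightarrow> nat \<Rightarrow> nat \<Rightarrow> state \<Rightarrow> state" where
  "nwrite x i v \<sigma> = \<sigma>\<lparr>nmem := (nmem \<sigma>)(x := (nmem \<sigma> x)(i := v))\<rparr>"

definition rwrite :: "string \<Rightarrow> nat \<Rightarrow> real \<Rightarrow> state \<Rightarrow> state" where
  "rwrite x i v \<sigma> = \<sigma>\<lparr>rmem := (rmem \<sigma>)(x := (rmem \<sigma> x)(i := v))\<rparr>"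

text \<open>\<open>exec P \<sigma> T \<sigma>'\<close>: started in \<open>\<sigma>\<close>, the program \<open>P\<close> halts after exactly \<open>T\<close> time units in \<open>\<sigma>'\<close>.\<close>

inductive exec :: "com \<Rightarrow> state \<Rightarrow> nat \<Rightarrow> state \<Rightarrow> bool" where
  Skip: "exec Skip \<sigma> 1 \<sigma>"
| NAssign: "exec (NAssign x i e) \<sigma> (1 + ntime i + ntime e) (nwrite x (nval i \<sigma>) (nval e \<sigma>) \<sigma>)"
| RAssign: "exec (RAssign x i e) \<sigma> (1 + ntime i + rtime e) (rwrite x (nval i \<sigma>) (rval e \<sigma>) \<sigma>)"
| Seq: "exec P \<sigma> T \<sigma>' \<Longrightarrow> exec Q \<sigma>' T' \<sigma>'' \<Longrightarrow> exec (Seq P Q) \<sigma> (T + T') \<sigma>''"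
| IfTrue: "bval b \<sigma> \<Longrightarrow> exec P \<sigma> T \<sigma>' \<Longrightarrow> exec (Ite b P Q) \<sigma> (1 + btime b + T) \<sigma>'"
| IfFalse: "\<not> bval b \<sigma> \<Longrightarrow> exec Q \<sigma> T \<sigma>' \<Longrightarrow> exec (Ite b P Q) \<sigma> (1 + btime b + T) \<sigma>'"
| WhileFalse: "\<not> bval b \<sigma> \<Longrightarrow> exec (While b P) \<sigma> (1 + btime b) \<sigma>"
| WhileTrue: "bval b \<sigma> \<Longrightarrow> exec P \<sigma> T \<sigma>' \<Longrightarrow> exec (While b P) \<sigma>' T' \<sigma>'' \<Longrightarrow>
    exec (While b P) \<sigma> (1 + btime b + T + T') \<sigma>''"

inductive_cases exec_cases:
  "exec Skip \<sigma> T \<sigma>'"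
  "exec (NAssign x i e) \<sigma> T \<sigma>'"
  "exec (RAssign x i e) \<sigma> T \<sigma>'"
  "exec (Seq P Q) \<sigma> T \<sigma>'"
  "exec (Ite b P Q) \<sigma> T \<sigma>'"
  "exec (While b P) \<sigma> T \<sigma>'"

lemma exec_deterministic:
  "exec P \<sigma> T \<sigma>' \<Longrightarrow> exec P \<sigma> U \<tau> \<Longrightarrow> T = U \<and> \<sigma>' = \<tau>"
proof (induction arbitrary: U \<tau> rule: exec.induct)
  case (Seq P \<sigma> T \<sigma>' Q T' \<sigma>'')
  obtain V V' \<rho> where *: "U = V + V'" "exec P \<sigma> V \<rho>" "exec Q \<rho> V' \<tau>"
    using Seq.prems by (rule exec_cases(4))
  have "T = V \<and> \<sigma>' = \<rho>" using Seq.IH(1)[OF *(2)] .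
  moreover from this have "T' = V' \<and> \<sigma>'' = \<tau>" using Seq.IH(2)[of V' \<tau>] *(3) by blast
  ultimately show ?case using *(1) by simp
next
  case (IfTrue b \<sigma> P T \<sigma>' Q)
  obtain V where *: "U = Suc (btime b + V)" "exec P \<sigma> V \<tau>"
    using IfTrue.prems by (rule exec_cases(5)) (use IfTrue.hyps(1) in blast)+
  show ?case using IfTrue.IH[OF *(2)] *(1) by simp
next
  case (IfFalse b \<sigma> Q T \<sigma>' P)
  obtain V where *: "U = Suc (btime b + V)" "exec Q \<sigma> V \<tau>"
    using IfFalse.prems by (rule exec_cases(5)) (use IfFalse.hyps(1) in blast)+
  show ?case using IfFalse.IH[OF *(2)] *(1) by simp
next
  case (WhileFalse b \<sigma> P)
  from WhileFalse.prems show ?case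
    by (rule exec_cases(6)) (use WhileFalse.hyps in simp_all)
next
  case (WhileTrue b \<sigma> P T \<sigma>' T' \<sigma>'')
  obtain V V' \<rho> where *: "U = Suc (btime b + V + V')" "exec P \<sigma> V \<rho>" "exec (While b P) \<rho> V' \<tau>"
    using WhileTrue.prems by (rule exec_cases(6)) (use WhileTrue.hyps(1) in blast)+
  have "T = V \<and> \<sigma>' = \<rho>" using WhileTrue.IH(1)[OF *(2)] .
  moreover from this have "T' = V' \<and> \<sigma>'' = \<tau>"
    using WhileTrue.IH(2)[of V' \<tau>] *(3) by blast
  ultimately show ?case using *(1) by simp
qed (elim exec_cases(1-3), simp)+

text \<open>
  A problem is given by its set of valid instances, the initial memory encoding an instance, the
  size of an instance, and the relation of being a correct final memory for an instance.
\<close>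
definition poly_time_solvable ::
  "('i \<Rightarrow> bool) \<Rightarrow> ('i \<Rightarrow> state) \<Rightarrow> ('i \<Rightarrow> nat) \<Rightarrow> ('i \<Rightarrow> state \<Rightarrow> bool) \<Rightarrow> bool" where
  "poly_time_solvable valid encode len correct \<longleftrightarrow>
     (\<exists>P (p :: nat poly). \<forall>I. valid I \<longrightarrow>
        (\<exists>T \<sigma>. exec P (encode I) T \<sigma> \<and> T \<le> poly p (len I) \<and> correct I \<sigma>))"


section \<open>Exact-Simultaneous-Dipaths as a computational problem\<close>

text \<open>As machine input, the vertices and the arcs are numbered consecutively from 0.\<close>

definition numbered :: "(nat, nat) pre_digraph \<Rightarrow> bool" where
  "numbered G \<longleftrightarrow> verts G = {..<card (verts G)} \<and> arcs G = {..<card (arcs G)}"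

definition esd_size :: "(nat, nat) esd \<Rightarrow> nat" where
  "esd_size I = card (verts (graph_of I)) + card (arcs (graph_of I))"

text \<open>
  The colour classes form a 0/1 matrix with one row of length \<open>k\<close> per arc: cell \<open>a * k + (i - 1)\<close>
  tells whether arc \<open>a\<close> belongs to the \<open>i\<close>-th class. All cells not listed, in particular those of
  \<open>tail\<close>, \<open>head\<close> and \<open>cost\<close> at indices that are not arcs, are 0.
\<close>
definition esd_encode :: "nat \<Rightarrow> (nat, nat) esd \<Rightarrow> state" where
  "esd_encode k I =
     (let G = graph_of I;
          scalar = (\<lambda>v j. if j = 0 then v else 0)
      in \<lparr>nmem = (\<lambda>_ _. 0)
            (''n'' := scalar (card (verts G)),
             ''m'' := scalar (card (arcs G)),
             ''source'' := scalar (source I),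
             ''target'' := scalar (target I),
             ''tail'' := (\<lambda>a. if a \<in> arcs G then tail G a else 0),
             ''head'' := (\<lambda>a. if a \<in> arcs G then head G a else 0),
             ''colour'' := (\<lambda>j. if j div k \<in> arcs G \<and> j div k \<in> colour I (j mod k + 1) then 1 else 0)),
          rmem = (\<lambda>_ _. 0)
            (''cost'' := (\<lambda>a. if a \<in> arcs G then cost I a else 0))\<rparr>)"

text \<open>
  On halting, cell 0 of \<open>feasible\<close> tells whether a feasible set exists, and if so,
  \<open>solution\<close> holds the characteristic vector of an optimal one.
\<close>
definition esd_correct :: "nat \<Rightarrow> (nat, nat) esd \<Rightarrow> state \<Rightarrow> bool" where
  "esd_correct k I \<sigma> \<longleftrightarrow>
     (if \<exists>B. esd_feasible k I B
      then nmem \<sigma> ''feasible'' 0 = 1 \<and>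
           esd_optimal k I {a \<in> arcs (graph_of I). nmem \<sigma> ''solution'' a = 1}
      else nmem \<sigma> ''feasible'' 0 = 0)"

end

theory Submission
  imports Defs
begin

text \<open>
  Grow the \<open>k\<close> paths simultaneously. A partial solution is a set \<open>B\<close> of arcs together with a tuple
  \<open>f\<close> of vertices such that, for each colour \<open>i\<close>, the arcs of colour \<open>i\<close> in \<open>B\<close> form a walk from the
  source to \<open>f i\<close>. An arc \<open>a\<close> may be added when \<open>f i\<close> is the tail of \<open>a\<close> for every colour \<open>i\<close> of \<open>a\<close>; all
  these entries of \<open>f\<close> then move to the head of \<open>a\<close>. Acyclicity ensures that such an arc is not yet in
  \<open>B\<close>, so costs add up, and conversely that every nonempty partial solution arises by adding an arc of
  \<open>B\<close> with topologically last tail. An optimal solution is hence a shortest path in the graph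
  of the \<open>n ^ k\<close> tuples. It uses at most \<open>m\<close> arcs, so \<open>m\<close> Bellman-Ford rounds suffice.
\<close>

section \<open>Counting-loop programs\<close>

text \<open>The only loops count from 0 up to a bound, so \<open>run\<close> is a total function
  defined by recursion on the syntax, and a time bound can be read off the program text.\<close>

datatype prog =
    PSkip
  | PN string nexp nexp
  | PR string nexp rexp
  | PSeq prog prog (infixr \<open>;;\<close> 60)
  | PIf bexp prog prog
  | PFor string string prog

abbreviation scalar :: "string \<Rightarrow> nexp" where
  "scalar x \<equiv> NCell x (NConst 0)"

text \<open>A loop reads its bound once, on entry, whereas the compiled \<open>While\<close> rereads
  bound and counter before every iteration. The two agree under \<open>well_formed\<close>, which
  forbids the body to write either of them.\<close>

primrec run :: "prog \<Rightarrow> state \<Rightarrow> state" where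
  "run PSkip \<sigma> = \<sigma>"
| "run (PN x i e) \<sigma> = nwrite x (nval i \<sigma>) (nval e \<sigma>) \<sigma>"
| "run (PR x i e) \<sigma> = rwrite x (nval i \<sigma>) (rval e \<sigma>) \<sigma>"
| "run (p ;; q) \<sigma> = run q (run p \<sigma>)"
| "run (PIf b p q) \<sigma> = (if bval b \<sigma> then run p \<sigma> else run q \<sigma>)"
| "run (PFor x y p) \<sigma> =
     fold (\<lambda>j \<tau>. nwrite x 0 (Suc j) (run p \<tau>)) [0..<nmem \<sigma> y 0] (nwrite x 0 0 \<sigma>)"

primrec compile :: "prog \<Rightarrow> com" where
  "compile PSkip = Skip"
| "compile (PN x i e) = NAssign x i e"
| "compile (PR x i e) = RAssign x i e"
| "compile (p ;; q) = Seq (compile p) (compile q)"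
| "compile (PIf b p q) = Ite b (compile p) (compile q)"
| "compile (PFor x y p) = Seq (NAssign x (NConst 0) (NConst 0))
     (While (NLess (scalar x) (scalar y))
       (Seq (compile p) (NAssign x (NConst 0) (NPlus (scalar x) (NConst 1)))))"

primrec nwrites :: "prog \<Rightarrow> string set" where
  "nwrites PSkip = {}"
| "nwrites (PN x i e) = {x}"
| "nwrites (PR x i e) = {}"
| "nwrites (p ;; q) = nwrites p \<union> nwrites q"
| "nwrites (PIf b p q) = nwrites p \<union> nwrites q"
| "nwrites (PFor x y p) = insert x (nwrites p)"

primrec rwrites :: "prog \<Rightarrow> string set" where
  "rwrites PSkip = {}"
| "rwrites (PN x i e) = {}"
| "rwrites (PR x i e) = {x}"
| "rwrites (p ;; q) = rwrites p \<union> rwrites q"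
| "rwrites (PIf b p q) = rwrites p \<union> rwrites q"
| "rwrites (PFor x y p) = rwrites p"

primrec bounds :: "prog \<Rightarrow> string set" where
  "bounds PSkip = {}"
| "bounds (PN x i e) = {}"
| "bounds (PR x i e) = {}"
| "bounds (p ;; q) = bounds p \<union> bounds q"
| "bounds (PIf b p q) = bounds p \<union> bounds q"
| "bounds (PFor x y p) = insert y (bounds p)"

primrec well_formed :: "prog \<Rightarrow> bool" where
  "well_formed PSkip \<longleftrightarrow> True"
| "well_formed (PN x i e) \<longleftrightarrow> True"
| "well_formed (PR x i e) \<longleftrightarrow> True"
| "well_formed (p ;; q) \<longleftrightarrow> well_formed p \<and> well_formed q"
| "well_formed (PIf b p q) \<longleftrightarrow> well_formed p \<and> well_formed q"
| "well_formed (PFor x y p) \<longleftrightarrow> x \<noteq> y \<and> x \<notin> nwrites p \<and> y \<notin> nwrites p \<and> well_formed p"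

text \<open>The variable of the polynomial stands for a common upper bound on all loop bounds. For a
  loop, 9 is 3 for resetting the counter plus 6 for the final failing test; 12 is 6 for the
  increment plus 6 for a successful test. A conditional is charged for both branches.\<close>

primrec time_poly :: "prog \<Rightarrow> nat poly" where
  "time_poly PSkip = [:1:]"
| "time_poly (PN x i e) = [:1 + ntime i + ntime e:]"
| "time_poly (PR x i e) = [:1 + ntime i + rtime e:]"
| "time_poly (p ;; q) = time_poly p + time_poly q"
| "time_poly (PIf b p q) = [:1 + btime b:] + time_poly p + time_poly q"
| "time_poly (PFor x y p) = [:9:] + [:0, 1:] * (time_poly p + [:12:])"

section \<open>Frame rule, loop rule and running time of counting-loop programs\<close>

lemma nmem_nwrite [simp]: "nmem (nwrite x i v \<sigma>) = (nmem \<sigma>)(x := (nmem \<sigma> x)(i := v))"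
  and rmem_nwrite [simp]: "rmem (nwrite x i v \<sigma>) = rmem \<sigma>"
  and nmem_rwrite [simp]: "nmem (rwrite x i w \<sigma>) = nmem \<sigma>"
  and rmem_rwrite [simp]: "rmem (rwrite x i w \<sigma>) = (rmem \<sigma>)(x := (rmem \<sigma> x)(i := w))"
  by (simp_all add: nwrite_def rwrite_def)

lemma fold_upt_invariant:
  assumes "Inv a \<sigma>" and "\<And>j \<tau>. a \<le> j \<Longrightarrow> j < b \<Longrightarrow> Inv j \<tau> \<Longrightarrow> Inv (Suc j) (f j \<tau>)" and "a \<le> b"
  shows "Inv b (fold f [a..<b] \<sigma>)"
  using assms(3,2) by (induction b rule: dec_induct) (use assms(1) in auto)

lemma run_frame:
  "z \<notin> nwrites p \<Longrightarrow> nmem (run p \<sigma>) z = nmem \<sigma> z"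
  "z \<notin> rwrites p \<Longrightarrow> rmem (run p \<sigma>) z = rmem \<sigma> z"
proof (induction p arbitrary: \<sigma>)
  case (PFor x y p)
  {
    case 1
    show ?case unfolding run.simps
      by (rule fold_upt_invariant[where Inv = "\<lambda>_ \<tau>. nmem \<tau> z = nmem \<sigma> z"]) (use 1 PFor in auto)
  next
    case 2
    show ?case unfolding run.simps
      by (rule fold_upt_invariant[where Inv = "\<lambda>_ \<tau>. rmem \<tau> z = rmem \<sigma> z"]) (use 2 PFor in auto)
  }
qed auto

text \<open>\<open>N\<close> and \<open>R\<close> name the arrays that may have changed; this is the
  frame condition carried through loops and subprograms.\<close>

definition agree :: "string set \<Rightarrow> string set \<Rightarrow> state \<Rightarrow> state \<Rightarrow> bool" where
  "agree N R \<sigma> \<tau> \<longleftrightarrow> (\<forall>z. z \<notin> N \<longrightarrow> nmem \<tau> z = nmem \<sigma> z) \<and> (\<forall>z. z \<notin> R \<longrightarrow> rmem \<tau> z = rmem \<sigma> z)"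

lemma agree_nmem: "agree N R \<sigma> \<tau> \<Longrightarrow> z \<notin> N \<Longrightarrow> nmem \<tau> z = nmem \<sigma> z"
  and agree_rmem: "agree N R \<sigma> \<tau> \<Longrightarrow> z \<notin> R \<Longrightarrow> rmem \<tau> z = rmem \<sigma> z"
  by (auto simp: agree_def)

text \<open>A Hoare rule for counting loops. The user-supplied invariant is strengthened internally
  by the value of the counter and by the frame condition relative to the state before the loop, so
  both come for free in the step.\<close>

lemma run_PFor:
  assumes "well_formed (PFor x y p)"
    and "Inv 0 (nwrite x 0 0 \<sigma>)"
    and "\<And>j \<tau>. j < nmem \<sigma> y 0 \<Longrightarrow> nmem \<tau> x 0 = j \<Longrightarrow> agree (nwrites (PFor x y p)) (rwrites p) \<sigma> \<tau> \<Longrightarrow>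
           Inv j \<tau> \<Longrightarrow> Inv (Suc j) (nwrite x 0 (Suc j) (run p \<tau>))"
  shows "Inv (nmem \<sigma> y 0) (run (PFor x y p) \<sigma>)"
proof -
  define Inv' where "Inv' j \<tau> \<longleftrightarrow> nmem \<tau> x 0 = j \<and>
    agree (nwrites (PFor x y p)) (rwrites p) \<sigma> \<tau> \<and> Inv j \<tau>" for j \<tau>
  have "Inv' (nmem \<sigma> y 0) (run (PFor x y p) \<sigma>)"
    unfolding run.simps
  proof (rule fold_upt_invariant)
    show "Inv' 0 (nwrite x 0 0 \<sigma>)"
      using assms(2) by (simp add: Inv'_def agree_def)
    show "Inv' (Suc j) (nwrite x 0 (Suc j) (run p \<tau>))"
      if "j < nmem \<sigma> y 0" "Inv' j \<tau>" for j \<tau>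
      using that assms(1) assms(3)[of j \<tau>] by (auto simp: Inv'_def agree_def run_frame)
  qed simp
  then show ?thesis by (simp add: Inv'_def)
qed

text \<open>The induction runs over the start index \<open>a\<close>, downwards from
  \<open>b\<close>, because \<open>While\<close> unfolds at its first iteration, just as
  \<open>fold\<close> does on the list from \<open>a\<close> to \<open>b\<close>.\<close>

lemma exec_while_count:
  assumes body: "\<And>j \<tau>. j < b \<Longrightarrow> Inv j \<tau> \<Longrightarrow> \<exists>T. exec c \<tau> T (f j \<tau>) \<and> T \<le> t"
    and step: "\<And>j \<tau>. j < b \<Longrightarrow> Inv j \<tau> \<Longrightarrow> Inv (Suc j) (f j \<tau>)"
    and guard: "\<And>j \<tau>. Inv j \<tau> \<Longrightarrow> bval g \<tau> \<longleftrightarrow> j < b"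
    and "a \<le> b" "Inv a \<sigma>"
  shows "\<exists>T. exec (While g c) \<sigma> T (fold f [a..<b] \<sigma>) \<and> T \<le> (b - a) * (t + 1 + btime g) + 1 + btime g"
  using \<open>a \<le> b\<close> \<open>Inv a \<sigma>\<close>
proof (induction a arbitrary: \<sigma> rule: inc_induct)
  case base
  then have "\<not> bval g \<sigma>" using guard by blast
  then show ?case using exec.WhileFalse by auto
next
  case (step a)
  from body[OF step(2,4)] obtain T where T: "exec c \<sigma> T (f a \<sigma>)" "T \<le> t" by blast
  from step.IH[OF assms(2)[OF step(2,4)]] obtain T' where
    T': "exec (While g c) (f a \<sigma>) T' (fold f [Suc a..<b] (f a \<sigma>))"
      "T' \<le> (b - Suc a) * (t + 1 + btime g) + 1 + btime g" by blast
  have "bval g \<sigma>" using guard step by blast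
  from exec.WhileTrue[OF this T(1) T'(1)]
  have "exec (While g c) \<sigma> (1 + btime g + T + T') (fold f [a..<b] \<sigma>)"
    using step(2) by (simp add: upt_conv_Cons)
  moreover have "1 + btime g + T + T' \<le> (b - a) * (t + 1 + btime g) + 1 + btime g"
    using T(2) T'(2) Suc_diff_Suc[OF step(2), symmetric] by simp
  ultimately show ?case by blast
qed

text \<open>No loop bound is ever written, so the bound \<open>L\<close> on the initial values of
  all loop bounds persists through the run, and the syntactic estimate \<open>time_poly\<close>
  applies to every subprogram.\<close>

lemma exec_compile:
  assumes "well_formed p" "bounds p \<inter> nwrites p = {}" "\<forall>y\<in>bounds p. nmem \<sigma> y 0 \<le> L"
  shows "\<exists>T. exec (compile p) \<sigma> T (run p \<sigma>) \<and> T \<le> poly (time_poly p) L"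
  using assms
proof (induction p arbitrary: \<sigma>)
  case PSkip
  show ?case using exec.Skip by auto
next
  case (PN x i e)
  show ?case using exec.NAssign[of x i e \<sigma>] by auto
next
  case (PR x i e)
  show ?case using exec.RAssign[of x i e \<sigma>] by auto
next
  case (PSeq p q)
  obtain T where T: "exec (compile p) \<sigma> T (run p \<sigma>)" "T \<le> poly (time_poly p) L"
    using PSeq.IH(1)[of \<sigma>] PSeq.prems by auto
  have "nmem (run p \<sigma>) y 0 \<le> L" if "y \<in> bounds q" for y
    using PSeq.prems that run_frame(1)[of y p \<sigma>] by (cases "y \<in> nwrites p") auto
  then obtain T' where T': "exec (compile q) (run p \<sigma>) T' (run q (run p \<sigma>))"
      "T' \<le> poly (time_poly q) L"
    using PSeq.IH(2)[of "run p \<sigma>"] PSeq.prems by auto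
  show ?case using exec.Seq[OF T(1) T'(1)] T(2) T'(2) by auto
next
  case (PIf b p q)
  show ?case
  proof (cases "bval b \<sigma>")
    case True
    obtain T where T: "exec (compile p) \<sigma> T (run p \<sigma>)" "T \<le> poly (time_poly p) L"
      using PIf.IH(1)[of \<sigma>] PIf.prems by auto
    show ?thesis using exec.IfTrue[OF True T(1), of "compile q"] T(2) True
      by (intro exI[of _ "1 + btime b + T"]) simp
  next
    case False
    obtain T where T: "exec (compile q) \<sigma> T (run q \<sigma>)" "T \<le> poly (time_poly q) L"
      using PIf.IH(2)[of \<sigma>] PIf.prems by auto
    show ?thesis using exec.IfFalse[OF False T(1), of "compile p"] T(2) False
      by (intro exI[of _ "1 + btime b + T"]) simp
  qed
next
  case (PFor x y p)
  let ?b = "nmem \<sigma> y 0" and ?t = "poly (time_poly p) L"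
  let ?g = "NLess (scalar x) (scalar y)"
  let ?c = "Seq (compile p) (NAssign x (NConst 0) (NPlus (scalar x) (NConst 1)))"
  let ?f = "\<lambda>j \<tau>. nwrite x 0 (Suc j) (run p \<tau>)"
  \<comment> \<open>The frame part keeps \<open>y\<close> and the bounds of inner loops at their
    initial values, so the induction hypothesis applies in every iteration with the same
    \<open>L\<close>.\<close>
  define Inv where "Inv j \<tau> \<longleftrightarrow> nmem \<tau> x 0 = j \<and> agree (nwrites (PFor x y p)) (rwrites p) \<sigma> \<tau>" for j \<tau>
  have "\<exists>T. exec (While ?g ?c) (nwrite x 0 0 \<sigma>) T (fold ?f [0..<?b] (nwrite x 0 0 \<sigma>)) \<and>
      T \<le> (?b - 0) * (?t + 6 + 1 + btime ?g) + 1 + btime ?g"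
  proof (rule exec_while_count)
    fix j \<tau>
    assume j: "j < ?b" and Inv: "Inv j \<tau>"
    have "\<forall>z\<in>bounds p. nmem \<tau> z 0 \<le> L"
      using PFor.prems Inv by (auto simp: Inv_def agree_def)
    then obtain T where T: "exec (compile p) \<tau> T (run p \<tau>)" "T \<le> ?t"
      using PFor.IH[of \<tau>] PFor.prems by auto
    have "nmem (run p \<tau>) x 0 = j" using Inv PFor.prems by (simp add: Inv_def run_frame)
    with exec.Seq[OF T(1) exec.NAssign[of x "NConst 0" "NPlus (scalar x) (NConst 1)"]]
    have "exec ?c \<tau> (T + 6) (?f j \<tau>)" by (simp add: numeral_eq_Suc)
    then show "\<exists>T. exec ?c \<tau> T (?f j \<tau>) \<and> T \<le> ?t + 6" using T(2) by auto
    show "Inv (Suc j) (?f j \<tau>)" using Inv by (auto simp: Inv_def agree_def run_frame)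
  next
    show "bval ?g \<tau> \<longleftrightarrow> j < ?b" if "Inv j \<tau>" for j \<tau>
      using that PFor.prems by (auto simp: Inv_def agree_def)
    show "Inv 0 (nwrite x 0 0 \<sigma>)" by (simp add: Inv_def agree_def)
  qed simp
  then obtain T where T: "exec (While ?g ?c) (nwrite x 0 0 \<sigma>) T (run (PFor x y p) \<sigma>)"
      "T \<le> (?b - 0) * (?t + 6 + 1 + btime ?g) + 1 + btime ?g" by auto
  have "btime ?g = 5" by simp
  with T(2) have T_le: "T \<le> ?b * (?t + 12) + 6" by (simp only:) (simp add: add.commute)
  have "?b * (?t + 12) \<le> L * (?t + 12)" using PFor.prems by (intro mult_right_mono) auto
  with T_le have "3 + T \<le> 9 + L * (?t + 12)" by linarith
  moreover have "exec (compile (PFor x y p)) \<sigma> (3 + T) (run (PFor x y p) \<sigma>)"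
    using exec.Seq[OF exec.NAssign[of x "NConst 0" "NConst 0" \<sigma>], unfolded nval.simps, OF T(1)]
    by (simp add: numeral_eq_Suc)
  ultimately show ?case by (intro exI[of _ "3 + T"]) simp
qed

section \<open>Partial solutions\<close>

locale acyclic_multicolour = fin_digraph G for G :: "('v, 'a) pre_digraph" (structure) +
  fixes k :: nat and C :: "nat \<Rightarrow> 'a set" and s :: 'v
  assumes acyclic: "\<nexists>p. cycle p"
    and arcs_eq: "arcs G = (\<Union>i<k. C i)"
    and s_in: "s \<in> verts G"
begin

text \<open>For \<open>f\<close> constantly the target these turn out to be the feasible sets,
  because walks are paths here (\<open>awalk_apath\<close>). Only the values of \<open>f\<close>
  below \<open>k\<close> matter; later statements therefore often concern all functions that agree
  with \<open>f\<close> there.\<close>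

definition partial :: "'a set \<Rightarrow> (nat \<Rightarrow> 'v) \<Rightarrow> bool" where
  "partial B f \<longleftrightarrow> B \<subseteq> arcs G \<and> (\<forall>i<k. \<exists>p. awalk s p (f i) \<and> set p = B \<inter> C i)"

definition applicable :: "(nat \<Rightarrow> 'v) \<Rightarrow> 'a \<Rightarrow> bool" where
  "applicable f a \<longleftrightarrow> a \<in> arcs G \<and> (\<forall>i<k. a \<in> C i \<longrightarrow> f i = tail G a)"

definition move :: "(nat \<Rightarrow> 'v) \<Rightarrow> 'a \<Rightarrow> nat \<Rightarrow> 'v" where
  "move f a i = (if a \<in> C i then head G a else f i)"

section \<open>Walks in an acyclic digraph, and how partial solutions grow\<close>

lemma no_closed_awalk: "awalk u p u \<Longrightarrow> p = []"
  using closed_w_imp_cycle acyclic by (fastforce simp: closed_w_def)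

lemma awalk_distinct_verts: "awalk u p v \<Longrightarrow> distinct (awalk_verts u p)"
  using awalk_not_distinct_decomp[of u p v] no_closed_awalk by blast

text \<open>A repeated vertex would split off a nonempty closed subwalk. This allows paths to be
  extended arc by arc without checking simplicity.\<close>

lemma awalk_apath: "awalk u p v \<longleftrightarrow> apath u p v"
  using awalk_distinct_verts by (auto simp: apath_def)

lemma awalk_distinct: "awalk u p v \<Longrightarrow> distinct p"
  using distinct_verts_imp_distinct awalk_distinct_verts by blast

lemma partial_cong: "(\<And>i. i < k \<Longrightarrow> f i = g i) \<Longrightarrow> partial B f \<longleftrightarrow> partial B g"
  by (simp add: partial_def)

lemma applicable_cong: "(\<And>i. i < k \<Longrightarrow> f i = g i) \<Longrightarrow> applicable f a \<longleftrightarrow> applicable g a"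
  by (simp add: applicable_def)

lemma partial_finite: "partial B f \<Longrightarrow> finite B"
  using finite_subset[OF _ finite_arcs] by (simp add: partial_def)

lemma partial_empty_iff: "partial {} f \<longleftrightarrow> (\<forall>i<k. f i = s)"
  using s_in by (auto simp: partial_def awalk_Nil_iff)

lemma partial_verts: "partial B f \<Longrightarrow> i < k \<Longrightarrow> f i \<in> verts G"
  unfolding partial_def by (meson awalk_last_in_verts)

text \<open>The arc has some colour \<open>i\<close>, and the walk of that colour ends at the tail
  of \<open>a\<close>. If it contained \<open>a\<close>, its part from \<open>a\<close> on would be
  a nonempty closed walk. Freshness makes costs additive when \<open>a\<close> is inserted.\<close>

lemma applicable_fresh:
  assumes "partial B f" "applicable f a"
  shows "a \<notin> B"
proof
  assume "a \<in> B"
  from assms(2) obtain i where i: "i < k" "a \<in> C i" "f i = tail G a"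
    using arcs_eq by (auto simp: applicable_def)
  then obtain p where "awalk s p (tail G a)" "set p = B \<inter> C i"
    using assms(1) by (auto simp: partial_def)
  moreover from this \<open>a \<in> B\<close> i(2) have "a \<in> set p" by simp
  then obtain q r where "p = q @ a # r" by (meson split_list)
  ultimately have "awalk (tail G a) (a # r) (tail G a)" by (auto simp: awalk_Cons_iff)
  then show False using no_closed_awalk by blast
qed

lemma partial_move:
  assumes "partial B f" "applicable f a"
  shows "partial (insert a B) (move f a)"
  unfolding partial_def
proof (intro conjI allI impI)
  show "insert a B \<subseteq> arcs G" using assms by (auto simp: partial_def applicable_def)
  fix i assume "i < k"
  then obtain p where p: "awalk s p (f i)" "set p = B \<inter> C i"
    using assms(1) by (auto simp: partial_def)
  show "\<exists>p. awalk s p (move f a i) \<and> set p = insert a B \<inter> C i"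
  proof (cases "a \<in> C i")
    case True
    then have "f i = tail G a" "a \<in> arcs G" using assms(2) \<open>i < k\<close> by (auto simp: applicable_def)
    then have "awalk s (p @ [a]) (head G a)" using p(1) by (auto simp: awalk_simps)
    then show ?thesis using p(2) True by (intro exI[of _ "p @ [a]"]) (auto simp: move_def)
  qed (use p in \<open>auto simp: move_def\<close>)
qed

text \<open>The converse of \<open>partial_move\<close>: an arc of \<open>B\<close> without a
  successor in \<open>B\<close> is the last arc of every colour walk that uses it, so it can be
  removed from all of them at once.\<close>

lemma partial_last_arc:
  assumes B: "partial B f" "B \<noteq> {}"
  obtains a g where "a \<in> B" "partial (B - {a}) g" "applicable g a" "\<And>i. i < k \<Longrightarrow> f i = move g a i"
proof -
  \<comment> \<open>Relates consecutive arcs. A cycle of this relation would give a nonempty closed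
    walk, so on the finite arc set its converse is well-founded.\<close>
  let ?R = "{(a, b). a \<in> arcs G \<and> b \<in> arcs G \<and> head G a = tail G b}"
  have walk: "\<exists>p. awalk (tail G a) (a # p) (tail G b)" if "(a, b) \<in> ?R\<^sup>+" for a b
    using that
  proof (induction rule: trancl.induct)
    case (r_into_trancl a b)
    then show ?case by (intro exI[of _ "[]"]) (auto simp: awalk_simps)
  next
    case (trancl_into_trancl a b c)
    then obtain p where "awalk (tail G a) (a # p) (tail G b)" by blast
    then have "awalk (tail G a) (a # (p @ [b])) (tail G c)"
      using trancl_into_trancl.hyps(2) by (auto simp: awalk_simps)
    then show ?case by blast
  qed
  have "acyclic ?R"
    unfolding acyclic_def using walk no_closed_awalk by blast
  then have "acyclic (?R\<inverse>)" by (simp only: acyclic_converse)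
  moreover have "finite (?R\<inverse>)"
    by (rule finite_subset[of _ "arcs G \<times> arcs G"]) auto
  ultimately have "wf (?R\<inverse>)" by (rule finite_acyclic_wf[rotated])
  \<comment> \<open>Minimality for the converse relation: no arc of \<open>B\<close> starts where
    \<open>a\<close> ends.\<close>
  then obtain a where a: "a \<in> B" and last: "\<And>b. b \<in> B \<Longrightarrow> (a, b) \<notin> ?R"
    using B(2) by (metis (no_types, lifting) wfE_min' converse_iff)
  \<comment> \<open>Undoes the move along \<open>a\<close>: the colours of \<open>a\<close> step
    back to its tail.\<close>
  define g where "g i = (if a \<in> C i then tail G a else f i)" for i
  have BG: "B \<subseteq> arcs G" using B(1) by (simp add: partial_def)
  \<comment> \<open>An arc following \<open>a\<close> in the walk would be a successor of
    \<open>a\<close> in \<open>B\<close>, so \<open>a\<close> comes last; it does not occur in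
    \<open>q\<close> since arcs of a walk are distinct.\<close>
  have ex: "\<exists>q. awalk s (q @ [a]) (f i) \<and> set q = (B - {a}) \<inter> C i" if "i < k" "a \<in> C i" for i
  proof -
    from B(1) that obtain p where p: "awalk s p (f i)" "set p = B \<inter> C i"
      by (auto simp: partial_def)
    then have "a \<in> set p" using a that by simp
    then obtain q r where pq: "p = q @ a # r" by (meson split_list)
    have "r = []"
    proof (cases r)
      case (Cons b r')
      then have "awalk (head G a) (b # r') (f i)" using p(1) pq by (auto simp: awalk_simps)
      moreover have "b \<in> B" using p(2) pq Cons by auto
      ultimately have "(a, b) \<in> ?R" using a BG by (auto simp: awalk_simps)
      with last \<open>b \<in> B\<close> show ?thesis by blast
    qed
    with pq p awalk_distinct[OF p(1)] show ?thesis by (intro exI[of _ q]) auto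
  qed
  show ?thesis
  proof (rule that[OF a])
    show "partial (B - {a}) g"
      unfolding partial_def
    proof (intro conjI allI impI)
      fix i assume i: "i < k"
      show "\<exists>p. awalk s p (g i) \<and> set p = (B - {a}) \<inter> C i"
      proof (cases "a \<in> C i")
        case True
        from ex[OF i this] obtain q where "awalk s (q @ [a]) (f i)" "set q = (B - {a}) \<inter> C i" by blast
        moreover from this(1) have "awalk s q (tail G a)"
          by (metis awalk_append_iff awalk_Cons_iff)
        ultimately show ?thesis using True by (metis g_def)
      next
        case False
        then have "(B - {a}) \<inter> C i = B \<inter> C i" by blast
        with False B(1) i show ?thesis by (auto simp: partial_def g_def)
      qed
    qed (use BG in auto)
    show "applicable g a" using a BG by (auto simp: applicable_def g_def)
    fix i assume i: "i < k"
    show "f i = move g a i"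
    proof (cases "a \<in> C i")
      case True
      from ex[OF i this] obtain q where "awalk s (q @ [a]) (f i)" by blast
      then show ?thesis using True by (simp add: move_def awalk_simps)
    qed (simp add: move_def g_def)
  qed
qed

end

section \<open>The dynamic programming table\<close>

lemma digit_sum_less:
  fixes f :: "nat \<Rightarrow> nat"
  assumes "\<And>i. i < k \<Longrightarrow> f i < n"
  shows "(\<Sum>i<k. f i * n ^ i) < n ^ k"
  using assms
proof (induction k)
  case (Suc k)
  then have "(\<Sum>i<k. f i * n ^ i) < n ^ k" "Suc (f k) * n ^ k \<le> n * n ^ k"
    by (auto intro!: mult_right_mono simp: Suc_le_eq simp del: mult_Suc)
  then show ?case by simp
qed simp

text \<open>Division by \<open>n ^ k\<close> isolates the leading digit, because the lower digits
  sum to less than \<open>n ^ k\<close>; the rest is induction.\<close>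

lemma digit_sum_inj:
  fixes f g :: "nat \<Rightarrow> nat"
  assumes "\<And>i. i < k \<Longrightarrow> f i < n" "\<And>i. i < k \<Longrightarrow> g i < n"
    and "(\<Sum>i<k. f i * n ^ i) = (\<Sum>i<k. g i * n ^ i)" and "i < k"
  shows "f i = g i"
  using assms
proof (induction k)
  case (Suc k)
  let ?s = "\<lambda>f. \<Sum>i<k. f i * n ^ i"
  have less: "?s f < n ^ k" "?s g < n ^ k" using Suc.prems by (auto intro: digit_sum_less)
  have eq: "?s f + f k * n ^ k = ?s g + g k * n ^ k" using Suc.prems(3) by simp
  have "(?s h + h k * n ^ k) div n ^ k = h k" if "?s h < n ^ k" for h
    using that by (cases "n ^ k = 0") simp_all
  from this[OF less(1)] this[OF less(2)] eq have k: "f k = g k" by simp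
  with eq Suc.IH Suc.prems(1,2,4) show ?case by (cases "i = k") auto
qed simp

locale numbered_multicolour = acyclic_multicolour G k C s
  for G :: "(nat, nat) pre_digraph" (structure) and k C s +
  fixes n m t :: nat and cst :: "nat \<Rightarrow> real"
  assumes verts_eq: "verts G = {..<n}" and arcs_eq_lessThan: "arcs G = {..<m}"
    and t_in: "t \<in> verts G"
begin

text \<open>The entry of a tuple \<open>f\<close> occupies the block of \<open>m\<close> cells starting at \<open>idx f\<close>. The factor
  \<open>m + 1\<close> instead of \<open>m\<close> keeps addresses distinct also for \<open>m = 0\<close>.\<close>

definition idx :: "(nat \<Rightarrow> nat) \<Rightarrow> nat" where
  "idx f = (\<Sum>i<k. f i * (Suc m * n ^ i))"

definition tuple :: "(nat \<Rightarrow> nat) \<Rightarrow> bool" where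
  "tuple f \<longleftrightarrow> (\<forall>i<k. f i < n)"

definition arcs_at :: "(nat \<Rightarrow> nat) \<Rightarrow> nat \<Rightarrow> nat set" where
  "arcs_at so x = {a. a < m \<and> so (x + a) = 1}"

text \<open>Every flagged entry stores an actual partial solution together with its exact cost. The
  number of its arcs is left open, since updates are made in place and one round may add several
  arcs.\<close>

definition sound :: "(nat \<Rightarrow> nat) \<Rightarrow> (nat \<Rightarrow> real) \<Rightarrow> (nat \<Rightarrow> nat) \<Rightarrow> bool" where
  "sound fl di so \<longleftrightarrow> (\<forall>x. fl x \<le> 1) \<and> (\<forall>f. tuple f \<longrightarrow> fl (idx f) = 1 \<longrightarrow>
     partial (arcs_at so (idx f)) f \<and> di (idx f) = sum cst (arcs_at so (idx f)))"

text \<open>The Bellman-Ford guarantee after \<open>r\<close> rounds. It is only an upper bound on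
  the stored cost: solutions with more than \<open>r\<close> arcs may already have been
  found.\<close>

definition complete :: "nat \<Rightarrow> (nat \<Rightarrow> nat) \<Rightarrow> (nat \<Rightarrow> real) \<Rightarrow> bool" where
  "complete r fl di \<longleftrightarrow> (\<forall>f B. partial B f \<longrightarrow> card B \<le> r \<longrightarrow>
     fl (idx f) = 1 \<and> di (idx f) \<le> sum cst B)"

text \<open>The progress within a round: \<open>P\<close> collects the pairs of tuple and arc
  already treated. The bound refers to the cost of \<open>B\<close>, not to the current entry of
  \<open>f\<close>, because that entry may still decrease later in the round.\<close>

definition relaxed :: "nat \<Rightarrow> ((nat \<Rightarrow> nat) \<times> nat) set \<Rightarrow> (nat \<Rightarrow> nat) \<Rightarrow> (nat \<Rightarrow> real) \<Rightarrow> bool" where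
  "relaxed r P fl di \<longleftrightarrow> (\<forall>f a B. (f, a) \<in> P \<longrightarrow> applicable f a \<longrightarrow> partial B f \<longrightarrow> card B \<le> r \<longrightarrow>
     fl (idx (move f a)) = 1 \<and> di (idx (move f a)) \<le> sum cst B + cst a)"

definition improves :: "(nat \<Rightarrow> nat) \<Rightarrow> (nat \<Rightarrow> real) \<Rightarrow> (nat \<Rightarrow> nat) \<Rightarrow> (nat \<Rightarrow> real) \<Rightarrow> bool" where
  "improves fl di fl' di' \<longleftrightarrow> (\<forall>x. fl x = 1 \<longrightarrow> fl' x = 1 \<and> di' x \<le> di x)"

lemma idx_eq: "idx f = Suc m * (\<Sum>i<k. f i * n ^ i)"
  unfolding idx_def sum_distrib_left by (intro sum.cong) (auto simp: algebra_simps)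

lemma idx_cong: "(\<And>i. i < k \<Longrightarrow> f i = g i) \<Longrightarrow> idx f = idx g"
  by (simp add: idx_def)

text \<open>Offsets are below \<open>Suc m\<close>, so division by \<open>Suc m\<close> recovers the
  numeral of the tuple.\<close>

lemma idx_block_inj:
  assumes "tuple f" "tuple g" "idx f + a = idx g + b" "a < m" "b < m" "i < k"
  shows "f i = g i"
proof -
  let ?s = "\<lambda>f. \<Sum>i<k. f i * n ^ i"
  have "(Suc m * ?s f + a) div Suc m = (Suc m * ?s g + b) div Suc m"
    using assms(3) by (simp only: idx_eq)
  then have "?s f = ?s g" using assms(4,5) by (simp only: div_mult_self4) simp
  then show ?thesis
    using digit_sum_inj[of k f n g i] assms(1,2,6) by (simp add: tuple_def)
qed

text \<open>Stated separately so as to cover \<open>m = 0\<close>, where no offset below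
  \<open>m\<close> exists.\<close>

lemma idx_inj:
  assumes "tuple f" "tuple g" "idx f = idx g" "i < k"
  shows "f i = g i"
proof -
  have "(\<Sum>i<k. f i * n ^ i) = (\<Sum>i<k. g i * n ^ i)"
    using assms(3) by (simp only: idx_eq nat_mult_eq_cancel1[OF zero_less_Suc])
  then show ?thesis
    using digit_sum_inj[of k f n g i] assms(1,2,4) by (simp add: tuple_def)
qed

lemma partial_tuple: "partial B f \<Longrightarrow> tuple f"
  using partial_verts verts_eq by (auto simp: tuple_def)

lemma applicable_move_tuple: "tuple f \<Longrightarrow> applicable f a \<Longrightarrow> tuple (move f a)"
  using verts_eq head_in_verts[of a] by (auto simp: tuple_def applicable_def move_def)

text \<open>An applicable arc has a colour and is not a loop, so the move changes an entry of the
  tuple. Hence the block of \<open>f\<close> can be copied to that of \<open>move f a\<close>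
  without overlap.\<close>

lemma idx_move_disjoint:
  assumes "tuple f" "applicable f a" "b < m" "c < m"
  shows "idx (move f a) + b \<noteq> idx f + c"
proof
  assume eq: "idx (move f a) + b = idx f + c"
  from assms(2) obtain i where i: "i < k" "a \<in> C i" "f i = tail G a" "a \<in> arcs G"
    using arcs_eq by (auto simp: applicable_def)
  with idx_block_inj[OF applicable_move_tuple[OF assms(1,2)] assms(1) eq assms(3,4) i(1)]
  have "head G a = tail G a" by (auto simp: move_def)
  then have "awalk (tail G a) [a] (tail G a)" using i(4) by (simp add: awalk_simps)
  then show False using no_closed_awalk by blast
qed

lemma complete_improves: "complete r fl di \<Longrightarrow> improves fl di fl' di' \<Longrightarrow> complete r fl' di'"
  unfolding complete_def improves_def by (meson order_trans)

lemma relaxed_improves: "relaxed r P fl di \<Longrightarrow> improves fl di fl' di' \<Longrightarrow> relaxed r P fl' di'"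
  unfolding relaxed_def improves_def by (meson order_trans)

text \<open>By \<open>partial_last_arc\<close>, a nonempty partial solution with at most
  \<open>Suc r\<close> arcs is one with at most \<open>r\<close> arcs extended by an applicable arc,
  and that pair has been relaxed.\<close>

lemma complete_Suc:
  assumes "complete r fl di" "relaxed r ({f. tuple f} \<times> {..<m}) fl di"
  shows "complete (Suc r) fl di"
  unfolding complete_def
proof (intro allI impI)
  fix f B assume B: "partial B f" "card B \<le> Suc r"
  show "fl (idx f) = 1 \<and> di (idx f) \<le> sum cst B"
  proof (cases "B = {}")
    case True
    then show ?thesis using assms(1)[unfolded complete_def, rule_format, OF B(1)] by simp
  next
    case False
    obtain a g where ag: "a \<in> B" "partial (B - {a}) g" "applicable g a" "\<And>i. i < k \<Longrightarrow> f i = move g a i"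
      using partial_last_arc[OF B(1) False] by blast
    have fin: "finite B" using partial_finite B(1) .
    have "card (B - {a}) \<le> r" using ag(1) B(2) fin by simp
    moreover have "(g, a) \<in> {f. tuple f} \<times> {..<m}"
      using ag(2,3) partial_tuple arcs_eq_lessThan by (auto simp: applicable_def)
    ultimately have "fl (idx (move g a)) = 1 \<and> di (idx (move g a)) \<le> sum cst (B - {a}) + cst a"
      using assms(2) ag(2,3) unfolding relaxed_def by blast
    moreover have "sum cst B = sum cst (B - {a}) + cst a"
      using sum.remove[OF fin ag(1), of cst] by simp
    moreover have "idx f = idx (move g a)" using ag(4) by (rule idx_cong)
    ultimately show ?thesis by simp
  qed
qed

text \<open>Here \<open>so'\<close> is the solution array after the block of \<open>f\<close> has
  been copied to the block of \<open>move f a\<close> and the cell of \<open>a\<close> has been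
  set.\<close>

lemma sound_update:
  assumes sound: "sound fl di so" and f: "tuple f" "fl (idx f) = 1" and a: "applicable f a"
    and so': "\<And>c. so' c = (if c = idx (move f a) + a then 1
      else if idx (move f a) \<le> c \<and> c < idx (move f a) + m then so (idx f + (c - idx (move f a))) else so c)"
  shows "sound (fl(idx (move f a) := 1)) (di(idx (move f a) := di (idx f) + cst a)) so'"
proof -
  let ?y = "idx (move f a)"
  have am: "a < m" using a arcs_eq_lessThan by (auto simp: applicable_def)
  have P: "partial (arcs_at so (idx f)) f" "di (idx f) = sum cst (arcs_at so (idx f))"
    using sound f by (auto simp: sound_def)
  have new: "arcs_at so' ?y = insert a (arcs_at so (idx f))"
    using am by (auto simp: arcs_at_def so')
  have old: "arcs_at so' (idx g) = arcs_at so (idx g)" if g: "tuple g" "idx g \<noteq> ?y" for g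
  proof -
    have "so' (idx g + b) = so (idx g + b)" if b: "b < m" for b
    proof -
      have "idx g + b \<noteq> ?y + c" if "c < m" for c
        using idx_block_inj[OF g(1) applicable_move_tuple[OF f(1) a] _ b that]
          idx_cong[of g "move f a"] g(2) by blast
      \<comment> \<open>The first instance excludes the cell set for \<open>a\<close>, the second
        every cell of the copied block.\<close>
      from this[of a] this[of "idx g + b - ?y"] am
      have "idx g + b \<noteq> ?y + a" "\<not> (?y \<le> idx g + b \<and> idx g + b < ?y + m)" by linarith+
      then show ?thesis by (auto simp: so')
    qed
    then show ?thesis by (auto simp: arcs_at_def)
  qed
  show ?thesis
    unfolding sound_def
  proof (intro conjI allI impI)
    fix g assume g: "tuple g" "(fl(?y := 1)) (idx g) = 1"
    show "partial (arcs_at so' (idx g)) g"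
    proof (cases "idx g = ?y")
      case True
      then have "partial (arcs_at so' (idx g)) (move f a)"
        using partial_move[OF P(1) a] new by simp
      \<comment> \<open>Equal addresses make \<open>g\<close> and \<open>move f a\<close> agree
        below \<open>k\<close> only, which suffices by \<open>partial_cong\<close>.\<close>
      then show ?thesis
        using partial_cong[of g "move f a"] idx_inj[OF g(1) applicable_move_tuple[OF f(1) a] True]
        by blast
    qed (use g sound old in \<open>auto simp: sound_def\<close>)
    show "(di(?y := di (idx f) + cst a)) (idx g) = sum cst (arcs_at so' (idx g))"
    proof (cases "idx g = ?y")
      case True
      then show ?thesis
        using new P applicable_fresh[OF P(1) a] partial_finite[OF P(1)] by simp
    qed (use g sound old in \<open>auto simp: sound_def\<close>)
  qed (use sound in \<open>auto simp: sound_def\<close>)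
qed

text \<open>Covers both outcomes of an update, entry overwritten or kept: the last assumption
  compares with the entry of \<open>f\<close>, and completeness bounds that entry by the cost of
  every \<open>B\<close> with at most \<open>r\<close> arcs.\<close>

lemma relaxed_insert:
  assumes "complete r fl di" "improves fl di fl' di'" "relaxed r P fl di"
    and "applicable f a \<Longrightarrow> fl (idx f) = 1 \<Longrightarrow>
      fl' (idx (move f a)) = 1 \<and> di' (idx (move f a)) \<le> di (idx f) + cst a"
  shows "relaxed r (P \<union> {g. \<forall>i<k. g i = f i} \<times> {a}) fl' di'"
  unfolding relaxed_def
proof (intro allI impI)
  fix g b B
  assume *: "(g, b) \<in> P \<union> {g. \<forall>i<k. g i = f i} \<times> {a}" "applicable g b" "partial B g" "card B \<le> r"
  show "fl' (idx (move g b)) = 1 \<and> di' (idx (move g b)) \<le> sum cst B + cst b"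
  proof (cases "(g, b) \<in> P")
    case True
    then show ?thesis using relaxed_improves[OF assms(3,2)] * by (auto simp: relaxed_def)
  next
    case False
    then have g: "\<And>i. i < k \<Longrightarrow> g i = f i" and b: "b = a" using *(1) by auto
    have "idx g = idx f" using g by (rule idx_cong)
    moreover have "idx (move g a) = idx (move f a)" using g by (intro idx_cong) (simp add: move_def)
    moreover have "applicable f a" using *(2) applicable_cong[of g f] g b by blast
    moreover have "fl (idx g) = 1 \<and> di (idx g) \<le> sum cst B" using assms(1) *(3,4) by (auto simp: complete_def)
    ultimately show ?thesis using assms(4) b by simp
  qed
qed

end

section \<open>The program\<close>

text \<open>Multiplication by a constant, unrolled into additions as the machine has no
  product.\<close>

primrec times :: "nat \<Rightarrow> nexp \<Rightarrow> nexp" where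
  "times 0 e = NConst 0"
| "times (Suc j) e = NPlus e (times j e)"

definition neq :: "nexp \<Rightarrow> nexp \<Rightarrow> bexp" where
  "neq e f = BNot (BAnd (BNot (NLess e f)) (BNot (NLess f e)))"

text \<open>Adds \<open>h\<close> times the weight \<open>W[i]\<close> to \<open>acc\<close>. The
  loop runs up to \<open>n\<close> and tests \<open>j < h\<close>, since a loop bound must never be
  written and \<open>h\<close> is. The result is right only for \<open>h\<close> at most
  \<open>n\<close>.\<close>

definition addmul :: "string \<Rightarrow> prog" where
  "addmul acc = PFor ''j'' ''n'' (PIf (NLess (scalar ''j'') (scalar ''h''))
     (PN acc (NConst 0) (NPlus (scalar acc) (NCell ''W'' (scalar ''i'')))) PSkip)"

text \<open>Evaluates the numeral \<open>idx\<close>; \<open>e\<close> yields the digit at position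
  \<open>i\<close>.\<close>

definition address :: "string \<Rightarrow> nexp \<Rightarrow> prog" where
  "address acc e = PN acc (NConst 0) (NConst 0) ;;
     PFor ''i'' ''k'' (PN ''h'' (NConst 0) e ;; addmul acc)"

definition copy :: "string \<Rightarrow> nexp \<Rightarrow> string \<Rightarrow> nexp \<Rightarrow> prog" where
  "copy dst d src e = PFor ''b'' ''m''
     (PN dst (NPlus d (scalar ''b'')) (NCell src (NPlus e (scalar ''b''))))"

text \<open>Writes the moved tuple to \<open>u\<close> and records in \<open>ok\<close> whether the
  arc \<open>a\<close> is applicable to the tuple in \<open>v\<close>.\<close>

definition check :: "nat \<Rightarrow> prog" where
  "check k = PN ''ok'' (NConst 0) (NConst 1) ;; PFor ''i'' ''k''
     (PIf (NLess (NConst 0) (NCell ''colour'' (NPlus (times k (scalar ''a'')) (scalar ''i''))))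
       (PN ''u'' (scalar ''i'') (NCell ''head'' (scalar ''a'')) ;;
        PIf (neq (NCell ''v'' (scalar ''i'')) (NCell ''tail'' (scalar ''a'')))
          (PN ''ok'' (NConst 0) (NConst 0)) PSkip)
       (PN ''u'' (scalar ''i'') (NCell ''v'' (scalar ''i''))))"

text \<open>Without disjunction in the guard, "\<open>y\<close> is unflagged or gets cheaper" is
  expressed as a negated conjunction.\<close>

definition update :: prog where
  "update = PIf (BAnd (NLess (NConst 0) (scalar ''ok'')) (BAnd (NLess (NConst 0) (NCell ''flag'' (scalar ''x'')))
       (BNot (BAnd (NLess (NConst 0) (NCell ''flag'' (scalar ''y'')))
         (BNot (RLess (RPlus (RCell ''dist'' (scalar ''x'')) (RCell ''cost'' (scalar ''a'')))
            (RCell ''dist'' (scalar ''y''))))))))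
     (PN ''flag'' (scalar ''y'') (NConst 1) ;;
      PR ''dist'' (scalar ''y'') (RPlus (RCell ''dist'' (scalar ''x'')) (RCell ''cost'' (scalar ''a''))) ;;
      copy ''sol'' (scalar ''y'') ''sol'' (scalar ''x'') ;;
      PN ''sol'' (NPlus (scalar ''y'') (scalar ''a'')) (NConst 1))
     PSkip"

definition relax :: "nat \<Rightarrow> prog" where
  "relax k = check k ;; address ''x'' (NCell ''v'' (scalar ''i'')) ;;
     address ''y'' (NCell ''u'' (scalar ''i'')) ;; update"

text \<open>The \<open>k\<close> nested loops need \<open>k\<close> distinct counters; nonempty
  strings of hash signs also differ from all other array names used.\<close>

definition counter :: "nat \<Rightarrow> string" where
  "counter j = replicate (Suc j) (CHR ''#'')"

text \<open>Runs \<open>p\<close> for all values of the first \<open>j\<close> entries of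
  \<open>v\<close>. The nesting depth is part of the program text, which is where the constancy of
  \<open>k\<close> enters.\<close>

primrec nest :: "nat \<Rightarrow> prog \<Rightarrow> prog" where
  "nest 0 p = p"
| "nest (Suc j) p = PFor (counter j) ''n'' (PN ''v'' (NConst j) (scalar (counter j)) ;; nest j p)"

definition weights :: prog where
  "weights = PN ''W'' (NConst 0) (NPlus (scalar ''m'') (NConst 1)) ;;
     PFor ''i'' ''k'' (PN ''W'' (NPlus (scalar ''i'') (NConst 1)) (NConst 0) ;;
       PFor ''j'' ''n'' (PN ''W'' (NPlus (scalar ''i'') (NConst 1))
         (NPlus (NCell ''W'' (NPlus (scalar ''i'') (NConst 1))) (NCell ''W'' (scalar ''i'')))))"

text \<open>Memory initially zero already provides distance 0 and the empty set for the tuple of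
  sources; only its flag has to be set.\<close>

definition solver :: "nat \<Rightarrow> prog" where
  "solver k = weights ;; address ''x'' (scalar ''source'') ;; PN ''flag'' (scalar ''x'') (NConst 1) ;;
     PFor ''r'' ''m'' (nest k (PFor ''a'' ''m'' (relax k))) ;;
     address ''z'' (scalar ''target'') ;;
     PN ''feasible'' (NConst 0) (NCell ''flag'' (scalar ''z'')) ;;
     copy ''solution'' (NConst 0) ''sol'' (scalar ''z'')"

section \<open>Syntactic side conditions: write sets, loop bounds and well-formedness\<close>

lemma nval_times [simp]: "nval (times j e) \<sigma> = j * nval e \<sigma>"
  by (induction j) auto

lemma bval_neq [simp]: "bval (neq e f) \<sigma> \<longleftrightarrow> nval e \<sigma> \<noteq> nval f \<sigma>"
  by (auto simp: neq_def)

lemma agree_run: "agree (nwrites p) (rwrites p) \<sigma> (run p \<sigma>)"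
  by (simp add: agree_def run_frame)

lemma counter_eq_Cons [simp]:
  "counter j = c # cs \<longleftrightarrow> c = CHR ''#'' \<and> cs = replicate j (CHR ''#'')"
  "c # cs = counter j \<longleftrightarrow> c = CHR ''#'' \<and> cs = replicate j (CHR ''#'')"
  by (auto simp: counter_def)

lemma counter_notin: "\<forall>x\<in>A. hd x \<noteq> CHR ''#'' \<Longrightarrow> counter j \<notin> A"
  by (auto simp: counter_def)

lemma counter_inj [simp]: "counter i = counter j \<longleftrightarrow> i = j"
  by (metis Suc_inject counter_def length_replicate)

lemma nwrites_nest: "nwrites (nest j p) = nwrites p \<union> counter ` {..<j} \<union> (if j = 0 then {} else {''v''})"
  by (induction j) (auto simp: lessThan_Suc)

lemma bounds_nest: "bounds (nest j p) = bounds p \<union> (if j = 0 then {} else {''n''})"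
  by (induction j) auto

lemma well_formed_nest:
  assumes "well_formed p" "\<forall>x\<in>nwrites p. hd x \<noteq> CHR ''#''" "''n'' \<notin> nwrites p"
  shows "well_formed (nest j p)"
  using assms by (induction j) (auto simp: nwrites_nest counter_notin)

lemma nwrites_addmul [simp]: "nwrites (addmul acc) = {''j'', acc}"
  and rwrites_addmul [simp]: "rwrites (addmul acc) = {}"
  and bounds_addmul [simp]: "bounds (addmul acc) = {''n''}"
  and nwrites_address [simp]: "nwrites (address acc e) = {acc, ''i'', ''h'', ''j''}"
  and rwrites_address [simp]: "rwrites (address acc e) = {}"
  and bounds_address [simp]: "bounds (address acc e) = {''k'', ''n''}"
  and nwrites_copy [simp]: "nwrites (copy dst d src f) = {''b'', dst}"
  and rwrites_copy [simp]: "rwrites (copy dst d src f) = {}"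
  and bounds_copy [simp]: "bounds (copy dst d src f) = {''m''}"
  and nwrites_check [simp]: "nwrites (check k) = {''ok'', ''i'', ''u''}"
  and rwrites_check [simp]: "rwrites (check k) = {}"
  and bounds_check [simp]: "bounds (check k) = {''k''}"
  and nwrites_update [simp]: "nwrites update = {''flag'', ''b'', ''sol''}"
  and rwrites_update [simp]: "rwrites update = {''dist''}"
  and bounds_update [simp]: "bounds update = {''m''}"
  and nwrites_weights [simp]: "nwrites weights = {''W'', ''i'', ''j''}"
  and rwrites_weights [simp]: "rwrites weights = {}"
  and bounds_weights [simp]: "bounds weights = {''k'', ''n''}"
  by (auto simp: addmul_def address_def copy_def check_def update_def weights_def)

lemma nwrites_relax [simp]: "nwrites (relax k) =
    {''ok'', ''i'', ''u'', ''x'', ''h'', ''j'', ''y'', ''flag'', ''b'', ''sol''}"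
  and rwrites_relax [simp]: "rwrites (relax k) = {''dist''}"
  and bounds_relax [simp]: "bounds (relax k) = {''k'', ''n'', ''m''}"
  by (auto simp: relax_def)

lemma well_formed_addmul [simp]: "well_formed (addmul acc) \<longleftrightarrow> acc \<noteq> ''j'' \<and> acc \<noteq> ''n''"
  by (auto simp: addmul_def)

lemma well_formed_address [simp]:
  "well_formed (address acc e) \<longleftrightarrow> acc \<notin> {''j'', ''n'', ''i'', ''k''}"
  by (auto simp: address_def)

lemma well_formed_copy [simp]: "well_formed (copy dst d src e) \<longleftrightarrow> dst \<notin> {''b'', ''m''}"
  by (auto simp: copy_def)

lemma well_formed_check [simp]: "well_formed (check k)"
  by (simp add: check_def)

lemma well_formed_update [simp]: "well_formed update"
  by (simp add: update_def)

lemma well_formed_weights [simp]: "well_formed weights"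
  by (simp add: weights_def)

lemma well_formed_relax [simp]: "well_formed (relax k)"
  by (simp add: relax_def)

lemma well_formed_solver: "well_formed (solver k)"
  by (auto simp: solver_def well_formed_nest nwrites_nest)

lemma bounds_solver: "bounds (solver k) \<subseteq> {''n'', ''m'', ''k''}"
  by (auto simp: solver_def bounds_nest)

lemma nwrites_solver: "nwrites (solver k) \<inter> {''n'', ''m'', ''k''} = {}"
  by (auto simp: solver_def nwrites_nest)

section \<open>Effect of the subprograms on the memory\<close>

lemma run_addmul:
  assumes "acc \<notin> {''j'', ''n'', ''W'', ''i'', ''h''}" "nmem \<sigma> ''h'' 0 \<le> nmem \<sigma> ''n'' 0"
  shows "nmem (run (addmul acc) \<sigma>) acc 0 = nmem \<sigma> acc 0 + nmem \<sigma> ''h'' 0 * nmem \<sigma> ''W'' (nmem \<sigma> ''i'' 0)"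
proof -
  let ?h = "nmem \<sigma> ''h'' 0" and ?w = "nmem \<sigma> ''W'' (nmem \<sigma> ''i'' 0)"
  \<comment> \<open>After \<open>j\<close> iterations the weight has been added
    \<open>min j h\<close> times.\<close>
  have "nmem (run (addmul acc) \<sigma>) acc 0 = nmem \<sigma> acc 0 + min (nmem \<sigma> ''n'' 0) ?h * ?w"
    unfolding addmul_def
    by (rule run_PFor[where Inv = "\<lambda>j \<tau>. nmem \<tau> acc 0 = nmem \<sigma> acc 0 + min j ?h * ?w"])
      (use assms in \<open>auto simp: agree_def min_def algebra_simps\<close>)
  then show ?thesis using assms(2) by (simp add: min_def)
qed

text \<open>The expression \<open>e\<close> is evaluated afresh in each iteration, so its value is
  required in all states that differ from the initial one only in arrays written by the
  loop.\<close>

lemma run_address: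
  assumes acc: "acc \<notin> {''j'', ''n'', ''W'', ''i'', ''h'', ''k''}"
    and e: "\<And>c \<tau>. c < nmem \<sigma> ''k'' 0 \<Longrightarrow> agree {acc, ''i'', ''h'', ''j''} {} \<sigma> \<tau> \<Longrightarrow>
      nmem \<tau> ''i'' 0 = c \<Longrightarrow> nval e \<tau> = f c"
    and f: "\<And>c. c < nmem \<sigma> ''k'' 0 \<Longrightarrow> f c < nmem \<sigma> ''n'' 0"
  shows "nmem (run (address acc e) \<sigma>) acc 0 = (\<Sum>c<nmem \<sigma> ''k'' 0. f c * nmem \<sigma> ''W'' c)"
proof -
  let ?\<sigma> = "nwrite acc 0 0 \<sigma>" and ?p = "PN ''h'' (NConst 0) e ;; addmul acc"
  have "nmem (run (PFor ''i'' ''k'' ?p) ?\<sigma>) acc 0 = (\<Sum>c<nmem ?\<sigma> ''k'' 0. f c * nmem \<sigma> ''W'' c)"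
  proof (rule run_PFor[where Inv = "\<lambda>j \<tau>. nmem \<tau> acc 0 = (\<Sum>c<j. f c * nmem \<sigma> ''W'' c)"])
    fix c \<tau>
    assume c: "c < nmem ?\<sigma> ''k'' 0" and i: "nmem \<tau> ''i'' 0 = c"
      and ag: "agree (nwrites (PFor ''i'' ''k'' ?p)) (rwrites ?p) ?\<sigma> \<tau>"
      and Inv: "nmem \<tau> acc 0 = (\<Sum>c<c. f c * nmem \<sigma> ''W'' c)"
    have ck: "c < nmem \<sigma> ''k'' 0" using c acc by (auto split: if_splits)
    have ag': "agree {acc, ''i'', ''h'', ''j''} {} \<sigma> \<tau>" using ag by (auto simp: agree_def)
    have nv: "nval e \<tau> = f c" using e[OF ck ag' i] .
    let ?\<tau> = "nwrite ''h'' 0 (f c) \<tau>"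
    have "nmem ?\<tau> ''n'' 0 = nmem \<sigma> ''n'' 0" "nmem ?\<tau> ''W'' = nmem \<sigma> ''W''"
      using acc by (auto simp: agree_nmem[OF ag'])
    moreover from this have "nmem (run (addmul acc) ?\<tau>) acc 0 = nmem \<tau> acc 0 + f c * nmem \<sigma> ''W'' c"
      using run_addmul[of acc ?\<tau>] acc f[OF ck] i by simp
    ultimately show "nmem (nwrite ''i'' 0 (Suc c) (run ?p \<tau>)) acc 0 = (\<Sum>c<Suc c. f c * nmem \<sigma> ''W'' c)"
      using acc Inv nv by auto
  qed (use acc in auto)
  then show ?thesis using acc by (auto simp: address_def split: if_splits)
qed

text \<open>Source and destination may be the same array; the blocks must then be disjoint, so that
  no cell is overwritten before it is read.\<close>

lemma run_copy:
  assumes "dst \<notin> {''b'', ''m''}" "src \<noteq> ''b''"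
    and d: "\<And>\<tau>. agree {''b'', dst} {} \<sigma> \<tau> \<Longrightarrow> nval d \<tau> = D"
    and e: "\<And>\<tau>. agree {''b'', dst} {} \<sigma> \<tau> \<Longrightarrow> nval e \<tau> = E"
    and disj: "\<And>i j. dst = src \<Longrightarrow> i < nmem \<sigma> ''m'' 0 \<Longrightarrow> j < nmem \<sigma> ''m'' 0 \<Longrightarrow> D + i \<noteq> E + j"
  shows "nmem (run (copy dst d src e) \<sigma>) dst =
    (\<lambda>c. if D \<le> c \<and> c < D + nmem \<sigma> ''m'' 0 then nmem \<sigma> src (E + (c - D)) else nmem \<sigma> dst c)"
  unfolding copy_def
proof (rule run_PFor[where Inv = "\<lambda>j \<tau>. nmem \<tau> dst =
    (\<lambda>c. if D \<le> c \<and> c < D + j then nmem \<sigma> src (E + (c - D)) else nmem \<sigma> dst c)"])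
  let ?p = "PN dst (NPlus d (scalar ''b'')) (NCell src (NPlus e (scalar ''b'')))"
  fix j \<tau>
  assume j: "j < nmem \<sigma> ''m'' 0" and b: "nmem \<tau> ''b'' 0 = j"
    and ag: "agree (nwrites (PFor ''b'' ''m'' ?p)) (rwrites ?p) \<sigma> \<tau>"
    and Inv: "nmem \<tau> dst = (\<lambda>c. if D \<le> c \<and> c < D + j then nmem \<sigma> src (E + (c - D)) else nmem \<sigma> dst c)"
  have ag': "agree {''b'', dst} {} \<sigma> \<tau>" using ag by simp
  have src: "nmem \<tau> src (E + j) = nmem \<sigma> src (E + j)"
  proof (cases "dst = src")
    case True
    have "\<not> (D \<le> E + j \<and> E + j < D + j)"
      using disj[OF True, of "E + j - D" j] j by linarith
    then show ?thesis using Inv True by auto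
  qed (use agree_nmem[OF ag', of src] assms(2) in auto)
  show "nmem (nwrite ''b'' 0 (Suc j) (run ?p \<tau>)) dst =
    (\<lambda>c. if D \<le> c \<and> c < D + Suc j then nmem \<sigma> src (E + (c - D)) else nmem \<sigma> dst c)"
    using assms(1) src b d[OF ag'] e[OF ag'] by (auto simp: Inv fun_eq_iff)
qed (use assms(1) in auto)

lemma run_check:
  fixes \<sigma> :: state and K :: nat and col :: "nat \<Rightarrow> bool" and T H :: nat
  assumes k: "nmem \<sigma> ''k'' 0 = K"
    and col: "\<And>c. c < K \<Longrightarrow> 0 < nmem \<sigma> ''colour'' (K * nmem \<sigma> ''a'' 0 + c) \<longleftrightarrow> col c"
    and T: "nmem \<sigma> ''tail'' (nmem \<sigma> ''a'' 0) = T" and H: "nmem \<sigma> ''head'' (nmem \<sigma> ''a'' 0) = H"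
  shows "(\<forall>c<K. nmem (run (check K) \<sigma>) ''u'' c = (if col c then H else nmem \<sigma> ''v'' c)) \<and>
    (0 < nmem (run (check K) \<sigma>) ''ok'' 0 \<longleftrightarrow> (\<forall>c<K. col c \<longrightarrow> nmem \<sigma> ''v'' c = T))"
proof -
  define Inv where "Inv j \<tau> \<longleftrightarrow>
    (\<forall>c<j. nmem \<tau> ''u'' c = (if col c then H else nmem \<sigma> ''v'' c)) \<and>
    (0 < nmem \<tau> ''ok'' 0 \<longleftrightarrow> (\<forall>c<j. col c \<longrightarrow> nmem \<sigma> ''v'' c = T))" for j and \<tau> :: state
  have "Inv (nmem (nwrite ''ok'' 0 1 \<sigma>) ''k'' 0) (run (check K) \<sigma>)"
    unfolding check_def run.simps(4) run.simps(2) nval.simps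
  proof (rule run_PFor)
    let ?i = "scalar ''i''" and ?a = "scalar ''a''"
    let ?p = "PIf (NLess (NConst 0) (NCell ''colour'' (NPlus (times K ?a) ?i)))
      (PN ''u'' ?i (NCell ''head'' ?a) ;;
       PIf (neq (NCell ''v'' ?i) (NCell ''tail'' ?a)) (PN ''ok'' (NConst 0) (NConst 0)) PSkip)
      (PN ''u'' ?i (NCell ''v'' ?i))"
    let ?\<sigma> = "nwrite ''ok'' 0 1 \<sigma>"
    fix j \<tau>
    assume j: "j < nmem ?\<sigma> ''k'' 0" "nmem \<tau> ''i'' 0 = j"
      and ag: "agree (nwrites (PFor ''i'' ''k'' ?p)) (rwrites ?p) ?\<sigma> \<tau>" and Inv: "Inv j \<tau>"
    have eqs: "nmem \<tau> ''a'' = nmem \<sigma> ''a''" "nmem \<tau> ''v'' = nmem \<sigma> ''v''" "nmem \<tau> ''head'' = nmem \<sigma> ''head''"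
      "nmem \<tau> ''tail'' = nmem \<sigma> ''tail''" "nmem \<tau> ''colour'' = nmem \<sigma> ''colour''"
      by (simp_all add: agree_nmem[OF ag])
    have "j < K" using j(1) k by simp
    then show "Inv (Suc j) (nwrite ''i'' 0 (Suc j) (run ?p \<tau>))"
      using Inv col[of j] T H j(2) by (auto simp: Inv_def eqs less_Suc_eq)
  qed (simp_all add: Inv_def)
  then show ?thesis using k by (simp add: Inv_def)
qed

lemma run_weights:
  assumes "c \<le> nmem \<sigma> ''k'' 0"
  shows "nmem (run weights \<sigma>) ''W'' c = Suc (nmem \<sigma> ''m'' 0) * nmem \<sigma> ''n'' 0 ^ c"
proof -
  let ?w = "\<lambda>c. Suc (nmem \<sigma> ''m'' 0) * nmem \<sigma> ''n'' 0 ^ c"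
  let ?q = "PN ''W'' (NPlus (scalar ''i'') (NConst 1))
         (NPlus (NCell ''W'' (NPlus (scalar ''i'') (NConst 1))) (NCell ''W'' (scalar ''i'')))"
  let ?p = "PN ''W'' (NPlus (scalar ''i'') (NConst 1)) (NConst 0) ;; PFor ''j'' ''n'' ?q"
  let ?\<sigma> = "nwrite ''W'' 0 (Suc (nmem \<sigma> ''m'' 0)) \<sigma>"
  have "\<forall>c\<le>nmem ?\<sigma> ''k'' 0. nmem (run (PFor ''i'' ''k'' ?p) ?\<sigma>) ''W'' c = ?w c"
  proof (rule run_PFor[where Inv = "\<lambda>i \<tau>. \<forall>c\<le>i. nmem \<tau> ''W'' c = ?w c"])
    fix i \<tau>
    assume i: "nmem \<tau> ''i'' 0 = i" and ag: "agree (nwrites (PFor ''i'' ''k'' ?p)) (rwrites ?p) ?\<sigma> \<tau>"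
      and Inv: "\<forall>c\<le>i. nmem \<tau> ''W'' c = ?w c"
    let ?\<tau> = "nwrite ''W'' (Suc i) 0 \<tau>"
    have n: "nmem \<tau> ''n'' 0 = nmem \<sigma> ''n'' 0" using agree_nmem[OF ag, of "''n''"] by simp
    have "nmem (run (PFor ''j'' ''n'' ?q) ?\<tau>) ''W'' =
        (nmem \<tau> ''W'')(Suc i := nmem ?\<tau> ''n'' 0 * nmem \<tau> ''W'' i)"
    proof (rule run_PFor[where Inv = "\<lambda>j \<rho>. nmem \<rho> ''W'' = (nmem \<tau> ''W'')(Suc i := j * nmem \<tau> ''W'' i)"])
      fix j \<rho>
      assume ag: "agree (nwrites (PFor ''j'' ''n'' ?q)) (rwrites ?q) ?\<tau> \<rho>"
        and Inv: "nmem \<rho> ''W'' = (nmem \<tau> ''W'')(Suc i := j * nmem \<tau> ''W'' i)"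
      have "nmem \<rho> ''i'' 0 = i" using agree_nmem[OF ag, of "''i''"] i by simp
      with Inv show "nmem (nwrite ''j'' 0 (Suc j) (run ?q \<rho>)) ''W'' =
          (nmem \<tau> ''W'')(Suc i := Suc j * nmem \<tau> ''W'' i)"
        by (simp add: algebra_simps)
    qed simp_all
    with i n Inv show "\<forall>c\<le>Suc i. nmem (nwrite ''i'' 0 (Suc i) (run ?p \<tau>)) ''W'' c = ?w c"
      by (auto simp: le_Suc_eq algebra_simps)
  qed auto
  then show ?thesis using assms by (simp add: weights_def)
qed

text \<open>\<open>Q\<close> is the set of tuples visited so far. An invariant that is insensitive
  to \<open>v\<close> and the counters, and to which \<open>p\<close> adds the tuple in
  \<open>v\<close>, ends up with all tuples whose first \<open>j\<close> entries range freely below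
  \<open>n\<close>.\<close>

lemma run_nest:
  fixes Inv :: "(nat \<Rightarrow> nat) set \<Rightarrow> state \<Rightarrow> bool"
  assumes step: "\<And>Q \<sigma>. Inv Q \<sigma> \<Longrightarrow> (\<And>i. i < k \<Longrightarrow> nmem \<sigma> ''v'' i < n) \<Longrightarrow>
      Inv (Q \<union> {g. \<forall>i<k. g i = nmem \<sigma> ''v'' i}) (run p \<sigma>)"
    and frame: "\<And>Q \<sigma> \<tau>. Inv Q \<sigma> \<Longrightarrow> agree (insert ''v'' (range counter)) {} \<sigma> \<tau> \<Longrightarrow> Inv Q \<tau>"
    and n: "\<And>Q \<sigma>. Inv Q \<sigma> \<Longrightarrow> nmem \<sigma> ''n'' 0 = n"
    and p: "well_formed p" "\<forall>x\<in>nwrites p. hd x \<noteq> CHR ''#''" "''n'' \<notin> nwrites p" "''v'' \<notin> nwrites p"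
  assumes "j \<le> k" "Inv Q \<sigma>" "\<And>i. j \<le> i \<Longrightarrow> i < k \<Longrightarrow> nmem \<sigma> ''v'' i < n"
  shows "Inv (Q \<union> {g. (\<forall>i<j. g i < n) \<and> (\<forall>i. j \<le> i \<and> i < k \<longrightarrow> g i = nmem \<sigma> ''v'' i)}) (run (nest j p) \<sigma>) \<and>
    (\<forall>i\<ge>j. nmem (run (nest j p) \<sigma>) ''v'' i = nmem \<sigma> ''v'' i)"
  using assms(8-)
proof (induction j arbitrary: Q \<sigma>)
  case 0
  show ?case using step[OF 0(2)] 0(3) p(4) by (simp add: run_frame)
next
  case (Suc j)
  \<comment> \<open>The tuples visited once the outermost counter has reached \<open>c\<close>. The
    inner nest contributes those with \<open>g j = c\<close>, turning \<open>?P c\<close> into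
    \<open>?P (Suc c)\<close>.\<close>
  let ?P = "\<lambda>c. {g. (\<forall>i<j. g i < n) \<and> g j < c \<and> (\<forall>i. Suc j \<le> i \<and> i < k \<longrightarrow> g i = nmem \<sigma> ''v'' i)}"
  let ?q = "PN ''v'' (NConst j) (scalar (counter j)) ;; nest j p"
  have cv: "counter j \<noteq> ''v''" "counter j \<noteq> ''n''" by simp_all
  have wf: "well_formed (PFor (counter j) ''n'' ?q)"
    using well_formed_nest[OF p(1-3), of "Suc j"] by simp
  have "Inv (Q \<union> ?P (nmem \<sigma> ''n'' 0)) (run (PFor (counter j) ''n'' ?q) \<sigma>) \<and>
      (\<forall>i\<ge>Suc j. nmem (run (PFor (counter j) ''n'' ?q) \<sigma>) ''v'' i = nmem \<sigma> ''v'' i)"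
  proof (rule run_PFor[OF wf, where Inv = "\<lambda>c \<tau>. Inv (Q \<union> ?P c) \<tau> \<and>
      (\<forall>i\<ge>Suc j. nmem \<tau> ''v'' i = nmem \<sigma> ''v'' i)"])
    have "Inv Q (nwrite (counter j) 0 0 \<sigma>)"
      using frame[OF Suc.prems(2)] by (simp add: agree_def)
    then show "Inv (Q \<union> ?P 0) (nwrite (counter j) 0 0 \<sigma>) \<and>
        (\<forall>i\<ge>Suc j. nmem (nwrite (counter j) 0 0 \<sigma>) ''v'' i = nmem \<sigma> ''v'' i)"
      using cv by simp
  next
    fix c \<tau>
    assume c: "c < nmem \<sigma> ''n'' 0" "nmem \<tau> (counter j) 0 = c"
      and Inv: "Inv (Q \<union> ?P c) \<tau> \<and> (\<forall>i\<ge>Suc j. nmem \<tau> ''v'' i = nmem \<sigma> ''v'' i)"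
    let ?\<tau> = "nwrite ''v'' j c \<tau>" and ?\<rho> = "run (nest j p) (nwrite ''v'' j c \<tau>)"
    have cn: "c < n" using c n[OF Suc.prems(2)] by simp
    have I: "Inv (Q \<union> ?P c) ?\<tau>" using frame Inv by (auto simp: agree_def)
    have v: "nmem ?\<tau> ''v'' i < n" if "j \<le> i" "i < k" for i
      using that cn Inv Suc.prems(3) by (cases "i = j") auto
    have *: "Inv ((Q \<union> ?P c) \<union> {g. (\<forall>i<j. g i < n) \<and> (\<forall>i. j \<le> i \<and> i < k \<longrightarrow> g i = nmem ?\<tau> ''v'' i)}) ?\<rho> \<and>
        (\<forall>i\<ge>j. nmem ?\<rho> ''v'' i = nmem ?\<tau> ''v'' i)"
      using Suc.IH[OF _ I v] Suc.prems(1) by auto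
    have "{g. (\<forall>i<j. g i < n) \<and> (\<forall>i. j \<le> i \<and> i < k \<longrightarrow> g i = nmem ?\<tau> ''v'' i)} =
        {g. (\<forall>i<j. g i < n) \<and> g j = c \<and> (\<forall>i. Suc j \<le> i \<and> i < k \<longrightarrow> g i = nmem \<sigma> ''v'' i)}"
      using Inv Suc.prems(1) by (auto simp: le_eq_less_or_eq[of j] Suc_le_eq)
    then have "(Q \<union> ?P c) \<union> {g. (\<forall>i<j. g i < n) \<and> (\<forall>i. j \<le> i \<and> i < k \<longrightarrow> g i = nmem ?\<tau> ''v'' i)} =
        Q \<union> ?P (Suc c)" by (auto simp: less_Suc_eq)
    with * have "Inv (Q \<union> ?P (Suc c)) ?\<rho>" by simp
    then have "Inv (Q \<union> ?P (Suc c)) (nwrite (counter j) 0 (Suc c) ?\<rho>)"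
      by (rule frame) (simp add: agree_def)
    moreover have "nmem (nwrite (counter j) 0 (Suc c) ?\<rho>) ''v'' i = nmem \<sigma> ''v'' i" if "i \<ge> Suc j" for i
      using * Inv that cv by simp
    ultimately show "Inv (Q \<union> ?P (Suc c)) (nwrite (counter j) 0 (Suc c) (run ?q \<tau>)) \<and>
        (\<forall>i\<ge>Suc j. nmem (nwrite (counter j) 0 (Suc c) (run ?q \<tau>)) ''v'' i = nmem \<sigma> ''v'' i)"
      using c(2) by simp
  qed
  moreover have "?P n = {g. (\<forall>i<Suc j. g i < n) \<and> (\<forall>i. Suc j \<le> i \<and> i < k \<longrightarrow> g i = nmem \<sigma> ''v'' i)}"
    by (auto simp: less_Suc_eq)
  ultimately show ?case using n[OF Suc.prems(2)] by simp
qed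

section \<open>Correctness of the program\<close>

context numbered_multicolour
begin

section \<open>Memory invariants, one relaxation, one round, and the whole run\<close>

definition env :: "state \<Rightarrow> bool" where
  "env \<sigma> \<longleftrightarrow> nmem \<sigma> ''n'' 0 = n \<and> nmem \<sigma> ''m'' 0 = m \<and> nmem \<sigma> ''k'' 0 = k \<and>
     nmem \<sigma> ''source'' 0 = s \<and> nmem \<sigma> ''target'' 0 = t \<and>
     (\<forall>a<m. nmem \<sigma> ''tail'' a = tail G a \<and> nmem \<sigma> ''head'' a = head G a \<and> rmem \<sigma> ''cost'' a = cst a \<and>
       (\<forall>c<k. 0 < nmem \<sigma> ''colour'' (k * a + c) \<longleftrightarrow> a \<in> C c))"

definition ready :: "state \<Rightarrow> bool" where
  "ready \<sigma> \<longleftrightarrow> env \<sigma> \<and> (\<forall>c<k. nmem \<sigma> ''W'' c = Suc m * n ^ c)"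

definition table_inv :: "nat \<Rightarrow> ((nat \<Rightarrow> nat) \<times> nat) set \<Rightarrow> state \<Rightarrow> bool" where
  "table_inv r P \<sigma> \<longleftrightarrow> ready \<sigma> \<and> sound (nmem \<sigma> ''flag'') (rmem \<sigma> ''dist'') (nmem \<sigma> ''sol'') \<and>
     complete r (nmem \<sigma> ''flag'') (rmem \<sigma> ''dist'') \<and> relaxed r P (nmem \<sigma> ''flag'') (rmem \<sigma> ''dist'')"

lemma env_agree:
  assumes "env \<sigma>" "agree N R \<sigma> \<tau>"
    and "N \<inter> {''n'', ''m'', ''k'', ''source'', ''target'', ''tail'', ''head'', ''colour''} = {}" "''cost'' \<notin> R"
  shows "env \<tau>"
proof -
  have "''n'' \<notin> N" "''m'' \<notin> N" "''k'' \<notin> N" "''source'' \<notin> N" "''target'' \<notin> N"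
    "''tail'' \<notin> N" "''head'' \<notin> N" "''colour'' \<notin> N"
    using assms(3) by simp_all
  note eqs = this[THEN agree_nmem[OF assms(2)]] agree_rmem[OF assms(2,4)]
  show ?thesis using assms(1) unfolding env_def eqs .
qed

lemma ready_agree:
  assumes "ready \<sigma>" "agree N R \<sigma> \<tau>"
    and "N \<inter> {''n'', ''m'', ''k'', ''source'', ''target'', ''tail'', ''head'', ''colour'', ''W''} = {}" "''cost'' \<notin> R"
  shows "ready \<tau>"
proof -
  have "''W'' \<notin> N" using assms(3) by simp
  then have eq: "nmem \<tau> ''W'' = nmem \<sigma> ''W''" by (rule agree_nmem[OF assms(2)])
  have "env \<sigma>" using assms(1) unfolding ready_def by blast
  then have "env \<tau>" using assms(2) by (rule env_agree) (use assms(3,4) in simp_all)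
  then show ?thesis using assms(1) unfolding ready_def eq by blast
qed

lemma table_inv_agree:
  assumes "table_inv r P \<sigma>" "agree N R \<sigma> \<tau>"
    and "N \<inter> {''n'', ''m'', ''k'', ''source'', ''target'', ''tail'', ''head'', ''colour'', ''W'', ''flag'', ''sol''} = {}"
      "R \<inter> {''cost'', ''dist''} = {}"
  shows "table_inv r P \<tau>"
proof -
  have "''flag'' \<notin> N" "''sol'' \<notin> N" using assms(3) by simp_all
  moreover have "''dist'' \<notin> R" using assms(4) by simp
  ultimately have eqs: "nmem \<tau> ''flag'' = nmem \<sigma> ''flag''" "nmem \<tau> ''sol'' = nmem \<sigma> ''sol''"
    "rmem \<tau> ''dist'' = rmem \<sigma> ''dist''"
    by (simp_all add: agree_nmem[OF assms(2)] agree_rmem[OF assms(2)])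
  have "ready \<sigma>" using assms(1) unfolding table_inv_def by blast
  then have "ready \<tau>" using assms(2) by (rule ready_agree) (use assms(3,4) in simp_all)
  then show ?thesis using assms(1) unfolding table_inv_def eqs by blast
qed

lemma run_address_idx:
  assumes "ready \<sigma>" "tuple f" "acc \<notin> {''j'', ''n'', ''W'', ''i'', ''h'', ''k''}"
    and "\<And>c \<tau>. c < k \<Longrightarrow> agree {acc, ''i'', ''h'', ''j''} {} \<sigma> \<tau> \<Longrightarrow> nmem \<tau> ''i'' 0 = c \<Longrightarrow> nval e \<tau> = f c"
  shows "nmem (run (address acc e) \<sigma>) acc 0 = idx f"
proof -
  have k: "nmem \<sigma> ''k'' 0 = k" "nmem \<sigma> ''n'' 0 = n" using assms(1) by (auto simp: ready_def env_def)
  have "nmem (run (address acc e) \<sigma>) acc 0 = (\<Sum>c<nmem \<sigma> ''k'' 0. f c * nmem \<sigma> ''W'' c)"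
    using assms k by (intro run_address) (auto simp: tuple_def)
  also have "\<dots> = idx f"
    unfolding idx_def k using assms(1) by (intro sum.cong) (auto simp: ready_def)
  finally show ?thesis .
qed

text \<open>Unlike \<open>applicable_move_tuple\<close>, this must hold for every arc: the address
  of the moved tuple is computed before \<open>ok\<close> is tested.\<close>

lemma move_tuple: "tuple f \<Longrightarrow> a < m \<Longrightarrow> tuple (move f a)"
  using verts_eq head_in_verts[of a] arcs_eq_lessThan by (auto simp: tuple_def move_def)

lemma run_update:
  assumes inv: "table_inv r P \<sigma>" and f: "tuple f" and a: "a < m" "nmem \<sigma> ''a'' 0 = a"
    and x: "nmem \<sigma> ''x'' 0 = idx f" and y: "nmem \<sigma> ''y'' 0 = idx (move f a)"
    and ok: "0 < nmem \<sigma> ''ok'' 0 \<longleftrightarrow> applicable f a"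
  shows "table_inv r (P \<union> {g. \<forall>i<k. g i = f i} \<times> {a}) (run update \<sigma>)"
proof -
  let ?fl = "nmem \<sigma> ''flag''" and ?di = "rmem \<sigma> ''dist''" and ?so = "nmem \<sigma> ''sol''"
  let ?x = "idx f" and ?y = "idx (move f a)"
  let ?c = "applicable f a \<and> 0 < ?fl ?x \<and> \<not> (0 < ?fl ?y \<and> \<not> ?di ?x + cst a < ?di ?y)"
  have sound: "sound ?fl ?di ?so" and complete: "complete r ?fl ?di" and relaxed: "relaxed r P ?fl ?di"
    and ready: "ready \<sigma>" using inv by (auto simp: table_inv_def)
  have cost: "rmem \<sigma> ''cost'' a = cst a" and m: "nmem \<sigma> ''m'' 0 = m"
    using ready a by (auto simp: ready_def env_def)
  have le1: "?fl z \<le> 1" for z using sound by (simp add: sound_def)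
  have ready': "ready (run update \<sigma>)"
    by (rule ready_agree[OF ready agree_run]) auto
  show ?thesis
  proof (cases ?c)
    case True
    \<comment> \<open>The state after flag and distance have been written, just before the block is
      copied.\<close>
    define \<rho> where "\<rho> = rwrite ''dist'' ?y (?di ?x + cst a) (nwrite ''flag'' ?y 1 \<sigma>)"
    let ?cp = "copy ''sol'' (scalar ''y'') ''sol'' (scalar ''x'')"
    have run: "run update \<sigma> = nwrite ''sol'' (?y + a) 1 (run ?cp \<rho>)"
      using True x y a ok cost by (simp add: update_def run_frame \<rho>_def)
    have app: "applicable f a" and fx: "?fl ?x = 1" using True le1[of ?x] by auto
    have \<rho>: "nmem \<rho> ''sol'' = ?so" "nmem \<rho> ''m'' 0 = m" by (simp_all add: \<rho>_def m)
    have "nmem (run ?cp \<rho>) ''sol'' = (\<lambda>c. if ?y \<le> c \<and> c < ?y + nmem \<rho> ''m'' 0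
        then nmem \<rho> ''sol'' (?x + (c - ?y)) else nmem \<rho> ''sol'' c)"
      by (rule run_copy)
        (use x y m idx_move_disjoint[OF f app] in \<open>auto simp: agree_nmem \<rho>_def\<close>)
    then have cp: "nmem (run ?cp \<rho>) ''sol'' =
        (\<lambda>c. if ?y \<le> c \<and> c < ?y + m then ?so (?x + (c - ?y)) else ?so c)"
      unfolding \<rho> .
    have "sound (?fl(?y := 1)) (?di(?y := ?di ?x + cst a)) (nmem (run update \<sigma>) ''sol'')"
      by (rule sound_update[OF sound f fx app]) (simp add: run cp)
    moreover have imp: "improves ?fl ?di (?fl(?y := 1)) (?di(?y := ?di ?x + cst a))"
      using True by (auto simp: improves_def)
    moreover have "nmem (run update \<sigma>) ''flag'' = ?fl(?y := 1)"
      "rmem (run update \<sigma>) ''dist'' = ?di(?y := ?di ?x + cst a)"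
      by (simp_all add: run run_frame \<rho>_def)
    moreover have "relaxed r (P \<union> {g. \<forall>i<k. g i = f i} \<times> {a}) (?fl(?y := 1)) (?di(?y := ?di ?x + cst a))"
      by (rule relaxed_insert[OF complete imp relaxed]) simp
    ultimately show ?thesis
      using complete_improves[OF complete imp] ready' by (simp add: table_inv_def)
  next
    case False
    then have run: "run update \<sigma> = \<sigma>"
      using x y a ok cost by (auto simp: update_def)
    have "relaxed r (P \<union> {g. \<forall>i<k. g i = f i} \<times> {a}) ?fl ?di"
    \<comment> \<open>Nothing is written. If \<open>f\<close> is flagged and \<open>a\<close>
      applicable, the failed guard says that the entry of \<open>move f a\<close> is already flagged
      and no more expensive.\<close>
    proof (rule relaxed_insert[OF complete _ relaxed])
      assume "applicable f a" "?fl ?x = 1"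
      with False have "0 < ?fl ?y \<and> \<not> ?di ?x + cst a < ?di ?y" by simp
      with le1[of ?y] show "?fl ?y = 1 \<and> ?di ?y \<le> ?di ?x + cst a" by auto
    qed (simp add: improves_def)
    then show ?thesis using sound complete ready run by (simp add: table_inv_def)
  qed
qed

lemma run_relax:
  assumes inv: "table_inv r P \<sigma>" and f: "tuple (nmem \<sigma> ''v'')" and a: "a < m" "nmem \<sigma> ''a'' 0 = a"
  shows "table_inv r (P \<union> {g. \<forall>i<k. g i = nmem \<sigma> ''v'' i} \<times> {a}) (run (relax k) \<sigma>)"
proof -
  let ?f = "nmem \<sigma> ''v''"
  define \<sigma>1 where "\<sigma>1 = run (check k) \<sigma>"
  define \<sigma>2 where "\<sigma>2 = run (address ''x'' (NCell ''v'' (scalar ''i''))) \<sigma>1"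
  define \<sigma>3 where "\<sigma>3 = run (address ''y'' (NCell ''u'' (scalar ''i''))) \<sigma>2"
  have env: "env \<sigma>" using inv by (auto simp: table_inv_def ready_def)
  have ag1: "agree {''ok'', ''i'', ''u''} {} \<sigma> \<sigma>1"
    using agree_run[of "check k" \<sigma>] by (simp add: \<sigma>1_def)
  have ag2: "agree {''x'', ''i'', ''h'', ''j''} {} \<sigma>1 \<sigma>2"
    using agree_run[of "address ''x'' (NCell ''v'' (scalar ''i''))" \<sigma>1] by (simp add: \<sigma>2_def)
  have ag3: "agree {''y'', ''i'', ''h'', ''j''} {} \<sigma>2 \<sigma>3"
    using agree_run[of "address ''y'' (NCell ''u'' (scalar ''i''))" \<sigma>2] by (simp add: \<sigma>3_def)
  have inv1: "table_inv r P \<sigma>1" by (rule table_inv_agree[OF inv ag1]) auto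
  have inv2: "table_inv r P \<sigma>2" by (rule table_inv_agree[OF inv1 ag2]) auto
  have inv3: "table_inv r P \<sigma>3" by (rule table_inv_agree[OF inv2 ag3]) auto
  have 1: "(\<forall>c<k. nmem \<sigma>1 ''u'' c = (if a \<in> C c then head G a else ?f c)) \<and>
      (0 < nmem \<sigma>1 ''ok'' 0 \<longleftrightarrow> (\<forall>c<k. a \<in> C c \<longrightarrow> ?f c = tail G a))"
    unfolding \<sigma>1_def by (rule run_check) (use env a in \<open>auto simp: env_def\<close>)
  have ok: "0 < nmem \<sigma>1 ''ok'' 0 \<longleftrightarrow> applicable ?f a"
    using 1 a arcs_eq_lessThan by (auto simp: applicable_def)
  have u: "\<And>c. c < k \<Longrightarrow> nmem \<sigma>1 ''u'' c = move ?f a c" using 1 by (simp add: move_def)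
  have x: "nmem \<sigma>2 ''x'' 0 = idx ?f"
    unfolding \<sigma>2_def
    by (rule run_address_idx[OF _ f]) (use inv1 ag1 in \<open>auto simp: table_inv_def agree_nmem\<close>)
  have y: "nmem \<sigma>3 ''y'' 0 = idx (move ?f a)"
    unfolding \<sigma>3_def
    by (rule run_address_idx[OF _ move_tuple[OF f a(1)]])
      (use inv2 u ag2 in \<open>auto simp: table_inv_def agree_nmem\<close>)
  have "table_inv r (P \<union> {g. \<forall>i<k. g i = ?f i} \<times> {a}) (run update \<sigma>3)"
  proof (rule run_update[OF inv3 f a(1)])
    show "nmem \<sigma>3 ''a'' 0 = a" using a(2) by (simp add: agree_nmem[OF ag3] agree_nmem[OF ag2] agree_nmem[OF ag1])
    show "nmem \<sigma>3 ''x'' 0 = idx ?f" using x by (simp add: agree_nmem[OF ag3])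
    show "0 < nmem \<sigma>3 ''ok'' 0 \<longleftrightarrow> applicable ?f a" using ok by (simp add: agree_nmem[OF ag3] agree_nmem[OF ag2])
  qed (fact y)
  then show ?thesis by (simp add: relax_def \<sigma>1_def \<sigma>2_def \<sigma>3_def)
qed

lemma run_relax_arcs:
  assumes inv: "table_inv r (Q \<times> {..<m}) \<sigma>" and v: "\<And>i. i < k \<Longrightarrow> nmem \<sigma> ''v'' i < n"
  shows "table_inv r ((Q \<union> {g. \<forall>i<k. g i = nmem \<sigma> ''v'' i}) \<times> {..<m}) (run (PFor ''a'' ''m'' (relax k)) \<sigma>)"
proof -
  let ?E = "{g. \<forall>i<k. g i = nmem \<sigma> ''v'' i}"
  have m: "nmem \<sigma> ''m'' 0 = m" using inv by (auto simp: table_inv_def ready_def env_def)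
  have "table_inv r (Q \<times> {..<m} \<union> ?E \<times> {..<nmem \<sigma> ''m'' 0}) (run (PFor ''a'' ''m'' (relax k)) \<sigma>)"
  proof (rule run_PFor[where Inv = "\<lambda>a \<tau>. table_inv r (Q \<times> {..<m} \<union> ?E \<times> {..<a}) \<tau>"])
    have "table_inv r (Q \<times> {..<m}) (nwrite ''a'' 0 0 \<sigma>)"
      by (rule table_inv_agree[OF inv, of "{''a''}" "{}"]) (auto simp: agree_def)
    then show "table_inv r (Q \<times> {..<m} \<union> ?E \<times> {..<0}) (nwrite ''a'' 0 0 \<sigma>)" by simp
  next
    fix a \<tau>
    assume a: "a < nmem \<sigma> ''m'' 0" "nmem \<tau> ''a'' 0 = a"
      and ag: "agree (nwrites (PFor ''a'' ''m'' (relax k))) (rwrites (relax k)) \<sigma> \<tau>"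
      and inv: "table_inv r (Q \<times> {..<m} \<union> ?E \<times> {..<a}) \<tau>"
    have eq: "nmem \<tau> ''v'' = nmem \<sigma> ''v''" using agree_nmem[OF ag, of "''v''"] by simp
    let ?P = "Q \<times> {..<m} \<union> ?E \<times> {..<a} \<union> ?E \<times> {a}"
    have "table_inv r ?P (run (relax k) \<tau>)"
      using run_relax[OF inv, of a] v a m by (simp add: eq tuple_def)
    moreover have "?P = Q \<times> {..<m} \<union> ?E \<times> {..<Suc a}" by (auto simp: less_Suc_eq)
    ultimately have "table_inv r (Q \<times> {..<m} \<union> ?E \<times> {..<Suc a}) (run (relax k) \<tau>)" by simp
    then show "table_inv r (Q \<times> {..<m} \<union> ?E \<times> {..<Suc a}) (nwrite ''a'' 0 (Suc a) (run (relax k) \<tau>))"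
      by (rule table_inv_agree[of _ _ _ "{''a''}" "{}"]) (auto simp: agree_def)
  qed simp
  moreover have "Q \<times> {..<m} \<union> ?E \<times> {..<m} = (Q \<union> ?E) \<times> {..<m}" by blast
  ultimately show ?thesis by (simp only: m)
qed

text \<open>At the end of the nest every pair of a tuple and an arc has been relaxed, so
  \<open>complete_Suc\<close> applies; the next round starts again from the empty set of
  pairs.\<close>

lemma run_round:
  assumes "table_inv r {} \<sigma>"
  shows "table_inv (Suc r) {} (run (nest k (PFor ''a'' ''m'' (relax k))) \<sigma>)"
proof -
  let ?p = "PFor ''a'' ''m'' (relax k)"
  have "table_inv r (({} \<union> {g. (\<forall>i<k. g i < n) \<and> (\<forall>i. k \<le> i \<and> i < k \<longrightarrow> g i = nmem \<sigma> ''v'' i)}) \<times> {..<m})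
      (run (nest k ?p) \<sigma>) \<and> (\<forall>i\<ge>k. nmem (run (nest k ?p) \<sigma>) ''v'' i = nmem \<sigma> ''v'' i)"
  proof (rule run_nest[where Inv = "\<lambda>Q \<sigma>. table_inv r (Q \<times> {..<m}) \<sigma>"])
    show "table_inv r (Q \<times> {..<m}) \<tau>"
      if "table_inv r (Q \<times> {..<m}) \<sigma>" "agree (insert ''v'' (range counter)) {} \<sigma> \<tau>" for Q \<sigma> \<tau>
      using that by (rule table_inv_agree) auto
    show "nmem \<sigma> ''n'' 0 = n" if "table_inv r (Q \<times> {..<m}) \<sigma>" for Q \<sigma>
      using that by (auto simp: table_inv_def ready_def env_def)
  qed (use assms run_relax_arcs in auto)
  moreover have "{g. (\<forall>i<k. g i < n) \<and> (\<forall>i. k \<le> i \<and> i < k \<longrightarrow> g i = nmem \<sigma> ''v'' i)} = {f. tuple f}"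
    by (auto simp: tuple_def)
  ultimately have "table_inv r ({f. tuple f} \<times> {..<m}) (run (nest k ?p) \<sigma>)" by simp
  then show ?thesis
    using complete_Suc by (auto simp: table_inv_def relaxed_def[of _ "{}"])
qed

text \<open>The empty set is the only partial solution without arcs, and it belongs exactly to the
  tuples that equal the source below \<open>k\<close>.\<close>

lemma sound_complete_initial:
  "sound ((\<lambda>_. 0)(idx (\<lambda>_. s) := 1)) (\<lambda>_. 0) (\<lambda>_. 0) \<and>
   complete 0 ((\<lambda>_. 0)(idx (\<lambda>_. s) := 1)) (\<lambda>_. 0)"
proof
  have "tuple (\<lambda>_. s)" using s_in verts_eq by (simp add: tuple_def)
  then have "partial {} f" if "tuple f" "idx f = idx (\<lambda>_. s)" for f
    using idx_inj[OF that(1) _ that(2)] by (simp add: partial_empty_iff)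
  then show "sound ((\<lambda>_. 0)(idx (\<lambda>_. s) := 1)) (\<lambda>_. 0) (\<lambda>_. 0)"
    by (auto simp: sound_def arcs_at_def)
  have "B = {} \<and> idx f = idx (\<lambda>_. s)" if "partial B f" "card B \<le> 0" for B f
  proof -
    have "B = {}" using that partial_finite by simp
    then show ?thesis using that by (auto simp: partial_empty_iff intro: idx_cong)
  qed
  then show "complete 0 ((\<lambda>_. 0)(idx (\<lambda>_. s) := 1)) (\<lambda>_. 0)"
    unfolding complete_def by (metis fun_upd_same order_refl sum.empty)
qed

lemma run_solver:
  assumes env: "env \<sigma>" and zero: "nmem \<sigma> ''flag'' = (\<lambda>_. 0)" "nmem \<sigma> ''sol'' = (\<lambda>_. 0)" "rmem \<sigma> ''dist'' = (\<lambda>_. 0)"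
  defines "\<tau> \<equiv> run (solver k) \<sigma>"
  defines "S \<equiv> {a \<in> arcs G. nmem \<tau> ''solution'' a = 1}"
  shows "if \<exists>B. partial B (\<lambda>_. t)
    then nmem \<tau> ''feasible'' 0 = 1 \<and> partial S (\<lambda>_. t) \<and> (\<forall>B. partial B (\<lambda>_. t) \<longrightarrow> sum cst S \<le> sum cst B)
    else nmem \<tau> ''feasible'' 0 = 0"
proof -
  let ?round = "nest k (PFor ''a'' ''m'' (relax k))"
  define \<sigma>1 where "\<sigma>1 = run weights \<sigma>"
  define \<sigma>2 where "\<sigma>2 = run (address ''x'' (scalar ''source'')) \<sigma>1"
  define \<sigma>3 where "\<sigma>3 = nwrite ''flag'' (idx (\<lambda>_. s)) 1 \<sigma>2"
  define \<sigma>4 where "\<sigma>4 = run (PFor ''r'' ''m'' ?round) \<sigma>3"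
  define \<sigma>5 where "\<sigma>5 = run (address ''z'' (scalar ''target'')) \<sigma>4"
  define \<sigma>6 where "\<sigma>6 = nwrite ''feasible'' 0 (nmem \<sigma>5 ''flag'' (nmem \<sigma>5 ''z'' 0)) \<sigma>5"
  have ts: "tuple (\<lambda>_. s)" "tuple (\<lambda>_. t)" using s_in t_in verts_eq by (auto simp: tuple_def)
  have ag1: "agree {''W'', ''i'', ''j''} {} \<sigma> \<sigma>1"
    using agree_run[of weights \<sigma>] by (simp add: \<sigma>1_def)
  have ag2: "agree {''x'', ''i'', ''h'', ''j''} {} \<sigma>1 \<sigma>2"
    using agree_run[of "address ''x'' (scalar ''source'')" \<sigma>1] by (simp add: \<sigma>2_def)
  have ag5: "agree {''z'', ''i'', ''h'', ''j''} {} \<sigma>4 \<sigma>5"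
    using agree_run[of "address ''z'' (scalar ''target'')" \<sigma>4] by (simp add: \<sigma>5_def)
  have "env \<sigma>1" by (rule env_agree[OF env ag1]) auto
  then have ready1: "ready \<sigma>1"
    using run_weights[of _ \<sigma>] env by (simp add: ready_def env_def \<sigma>1_def)
  have x: "nmem \<sigma>2 ''x'' 0 = idx (\<lambda>_. s)"
    unfolding \<sigma>2_def
    by (rule run_address_idx[OF ready1 ts(1)]) (use ready1 in \<open>auto simp: ready_def env_def agree_nmem\<close>)
  have ready2: "ready \<sigma>2" by (rule ready_agree[OF ready1 ag2]) auto
  have ready3: "ready \<sigma>3"
    by (rule ready_agree[OF ready2, of "{''flag''}" "{}"]) (auto simp: agree_def \<sigma>3_def)
  have inv3: "table_inv 0 {} \<sigma>3"
    using sound_complete_initial ready3 zero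
    by (simp add: table_inv_def relaxed_def \<sigma>3_def agree_nmem[OF ag2] agree_nmem[OF ag1]
      agree_rmem[OF ag2] agree_rmem[OF ag1])
  have m3: "nmem \<sigma>3 ''m'' 0 = m" using ready3 by (simp add: ready_def env_def)
  have "table_inv (nmem \<sigma>3 ''m'' 0) {} \<sigma>4"
    unfolding \<sigma>4_def
  proof (rule run_PFor[where Inv = "\<lambda>r \<tau>. table_inv r {} \<tau>"])
    show "well_formed (PFor ''r'' ''m'' ?round)" by (auto simp: well_formed_nest nwrites_nest)
    show "table_inv 0 {} (nwrite ''r'' 0 0 \<sigma>3)"
      by (rule table_inv_agree[OF inv3, of "{''r''}" "{}"]) (auto simp: agree_def)
    fix r \<tau> assume "table_inv r {} \<tau>"
    then have "table_inv (Suc r) {} (run ?round \<tau>)" by (rule run_round)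
    then show "table_inv (Suc r) {} (nwrite ''r'' 0 (Suc r) (run ?round \<tau>))"
      by (rule table_inv_agree[of _ _ _ "{''r''}" "{}"]) (auto simp: agree_def)
  qed
  then have inv4: "table_inv m {} \<sigma>4" by (simp only: m3)
  then have inv5: "table_inv m {} \<sigma>5" by (rule table_inv_agree[OF _ ag5]) auto
  have ready4: "ready \<sigma>4" using inv4 by (simp add: table_inv_def)
  have z: "nmem \<sigma>5 ''z'' 0 = idx (\<lambda>_. t)"
    unfolding \<sigma>5_def
    by (rule run_address_idx[OF ready4 ts(2)]) (use ready4 in \<open>auto simp: ready_def env_def agree_nmem\<close>)
  have m5: "nmem \<sigma>5 ''m'' 0 = m" using inv5 by (simp add: table_inv_def ready_def env_def)
  have \<tau>: "\<tau> = run (copy ''solution'' (NConst 0) ''sol'' (scalar ''z'')) \<sigma>6"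
    by (simp add: \<tau>_def solver_def \<sigma>6_def \<sigma>5_def \<sigma>4_def \<sigma>3_def x[unfolded \<sigma>2_def \<sigma>1_def] \<sigma>2_def \<sigma>1_def
      del: run.simps(6))
  let ?z = "idx (\<lambda>_. t)" and ?fl = "nmem \<sigma>5 ''flag''" and ?so = "nmem \<sigma>5 ''sol''" and ?di = "rmem \<sigma>5 ''dist''"
  have feas: "nmem \<tau> ''feasible'' 0 = ?fl ?z"
    by (simp add: \<tau> run_frame \<sigma>6_def z)
  have "nmem \<tau> ''solution'' = (\<lambda>c. if 0 \<le> c \<and> c < 0 + nmem \<sigma>6 ''m'' 0
      then nmem \<sigma>6 ''sol'' (?z + (c - 0)) else nmem \<sigma>6 ''solution'' c)"
    unfolding \<tau> by (rule run_copy) (use z in \<open>auto simp: agree_nmem \<sigma>6_def\<close>)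
  then have S: "S = arcs_at ?so ?z"
    using m5 arcs_eq_lessThan by (auto simp: S_def arcs_at_def \<sigma>6_def)
  have sound: "sound ?fl ?di ?so" and complete: "complete m ?fl ?di"
    using inv5 by (auto simp: table_inv_def)
  \<comment> \<open>A partial solution is a set of arcs, hence has at most \<open>m\<close>
    elements, so completeness after \<open>m\<close> rounds covers all of them.\<close>
  have found: "?fl ?z = 1 \<and> ?di ?z \<le> sum cst B" if B: "partial B (\<lambda>_. t)" for B
  proof -
    have "card B \<le> m" using B arcs_eq_lessThan card_mono[of "{..<m}" B] by (auto simp: partial_def)
    then show ?thesis using complete B unfolding complete_def by blast
  qed
  have valid: "partial S (\<lambda>_. t) \<and> ?di ?z = sum cst S" if "?fl ?z = 1"
    using sound ts(2) that S by (auto simp: sound_def)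
  show ?thesis
  proof (cases "\<exists>B. partial B (\<lambda>_. t)")
    case True
    then have "?fl ?z = 1" using found by blast
    then show ?thesis using True valid found feas by auto
  next
    case False
    then have "?fl ?z \<noteq> 1" using valid by blast
    moreover have "?fl ?z \<le> 1" using sound by (simp add: sound_def)
    ultimately show ?thesis using False feas by simp
  qed
qed

end

section \<open>From partial solutions back to the computational problem\<close>

theorem theorem3p1:
  fixes k :: nat
  assumes "k \<ge> 1"
  shows "poly_time_solvable
    (\<lambda>I. esd_instance k I \<and> acyclic_digraph (graph_of I) \<and> numbered (graph_of I))
    (esd_encode k) esd_size (esd_correct k)"
  unfolding poly_time_solvable_def
proof (rule exI, rule exI, intro allI impI)
  fix I :: "(nat, nat) esd"
  assume I: "esd_instance k I \<and> acyclic_digraph (graph_of I) \<and> numbered (graph_of I)"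
  define G where "G = graph_of I"
  define n where "n = card (verts G)"
  define m where "m = card (arcs G)"
  \<comment> \<open>Colours are renumbered from 0, matching the column index in the encoded
    matrix.\<close>
  define C where "C i = colour I (Suc i)" for i
  \<comment> \<open>The encoding does not contain \<open>k\<close>; the program, which may depend on
    \<open>k\<close>, stores it as a constant.\<close>
  let ?init = "NAssign ''k'' (NConst 0) (NConst k)"
  let ?\<sigma> = "nwrite ''k'' 0 k (esd_encode k I)"
  have inst: "fin_digraph G" "arcs G = (\<Union>i\<in>{1..k}. colour I i)" "source I \<in> verts G" "target I \<in> verts G"
    and acyc: "\<nexists>p. pre_digraph.cycle G p" and num: "verts G = {..<n}" "arcs G = {..<m}"
    using I by (auto simp: esd_instance_def acyclic_digraph_def numbered_def G_def n_def m_def)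
  have one_to_k: "{1..k} = Suc ` {..<k}" by (simp add: image_Suc_lessThan)
  then have "(\<Union>i\<in>{1..k}. colour I i) = (\<Union>i<k. C i)" by (simp add: C_def image_image)
  then interpret numbered_multicolour G k C "source I" n m "target I" "cost I"
    using inst acyc num
    by (intro numbered_multicolour.intro acyclic_multicolour.intro acyclic_multicolour_axioms.intro
      numbered_multicolour_axioms.intro) auto
  have feasible_iff: "esd_feasible k I B \<longleftrightarrow> partial B (\<lambda>_. target I)" for B
    unfolding esd_feasible_def one_to_k
    by (auto simp: is_dipath_def partial_def awalk_apath C_def simp flip: G_def)
  have env: "env ?\<sigma>"
    unfolding env_def
    by (auto simp: esd_encode_def Let_def G_def[symmetric] n_def[symmetric] m_def[symmetric] num C_def)
  have "nmem ?\<sigma> ''flag'' = (\<lambda>_. 0)" "nmem ?\<sigma> ''sol'' = (\<lambda>_. 0)" "rmem ?\<sigma> ''dist'' = (\<lambda>_. 0)"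
    by (auto simp: esd_encode_def Let_def)
  from run_solver[OF env this]
  have correct: "esd_correct k I (run (solver k) ?\<sigma>)"
    by (simp add: esd_correct_def esd_optimal_def feasible_iff flip: G_def split: if_splits)
  have "\<forall>y\<in>bounds (solver k). nmem ?\<sigma> y 0 \<le> n + m + k"
    using bounds_solver[of k] env by (auto simp: env_def)
  moreover have "bounds (solver k) \<inter> nwrites (solver k) = {}"
    using bounds_solver[of k] nwrites_solver[of k] by blast
  ultimately obtain T where T: "exec (compile (solver k)) ?\<sigma> T (run (solver k) ?\<sigma>)"
      "T \<le> poly (time_poly (solver k)) (n + m + k)"
    using exec_compile[OF well_formed_solver] by blast
  have "exec (Seq ?init (compile (solver k))) (esd_encode k I) (3 + T) (run (solver k) ?\<sigma>)"
    using exec.Seq[OF exec.NAssign[of "''k''" "NConst 0" "NConst k" "esd_encode k I"], unfolded nval.simps, OF T(1)]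
    by (simp add: numeral_eq_Suc)
  \<comment> \<open>All loop bounds are at most \<open>n + m + k\<close>, so the size plus
    \<open>k\<close> is substituted for the variable of \<open>time_poly\<close>; 3 pays for storing
    \<open>k\<close>.\<close>
  moreover have "3 + T \<le> poly ([:3:] + pcompose (time_poly (solver k)) [:k, 1:]) (esd_size I)"
    using T(2) by (simp add: poly_pcompose esd_size_def G_def n_def m_def ac_simps)
  ultimately show "\<exists>T \<sigma>. exec (Seq ?init (compile (solver k))) (esd_encode k I) T \<sigma> \<and>
      T \<le> poly ([:3:] + pcompose (time_poly (solver k)) [:k, 1:]) (esd_size I) \<and> esd_correct k I \<sigma>"
    using correct by blast
qed

end
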